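(* Let $H$ be a fixed graph with at least two edges, and let $b=b(n)\ge 1$ be an integer-valued function that is subpolynomial in $n$. Then, as $n\to\infty$, $$\tau(\mathcal{H}_{H,n},b)=\left(\frac{1}{m_2(H)}+o(1)\right)\log_{b+1}(n),$$ where $\mathcal{H}_{H,n}$ is the hypergraph with vertex set $E(K_n)$ whose hyperedges are the edge sets of all copies of $H$ in $K_n$.
   Context: For a graph $G$, $v(G)$ and $e(G)$ denote its numbers of vertices and edges. The maximum 2-density of a graph $H$ with at least three vertices is $$m_2(H)=\max_{G\subseteq H,\ v(G)\ge 3}\frac{e(G)-1}{v(G)-2}.$$ A function $f(n)$ is subpolynomial in $n$ if $f(n)=o(n^{\varepsilon})$ for all $\varepsilon>0$. Multistage $(1:b)$ Maker-Breaker game on a hypergraph $\mathcal{H}=(\mathcal{X},\mathcal{F})$ (board $\mathcal{X}$, family of winning sets $\mathcal{F}$), $b\ge 1$ an integer: Put $\mathcal{X}_0:=\mathcal{X}$, $\mathcal{F}_0:=\mathcal{F}$. For $i\ge 1$, in Stage $i$ Maker and Breaker play on the board $\mathcal{X}_{i-1}$, alternating in turns in which Maker claims exactly one unclaimed element of $\mathcal{X}_{i-1}$ and afterwards Breaker claims up to $b$ unclaimed elements of $\mathcal{X}_{i-1}$, with Maker moving first. Once all elements of $\mathcal{X}_{i-1}$ have been distributed among the players, $\mathcal{X}_i\subseteq\mathcal{X}_{i-1}$ denotes the set of all elements claimed by Maker in Stage $i$, and $\mathcal{F}_i:=\{F\in\mathcal{F}_{i-1}: F\subseteq\mathcal{X}_i\}$.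 The game stops the first time no winning sets are left. The threshold parameter $\tau(\mathcal{H},b)$ is the largest number $s$ such that Maker has a strategy (against every play of Breaker) ensuring $\mathcal{F}_s\neq\varnothing$. *)

theory Defs
  imports Complex_Main "HOL-Library.Landau_Symbols"
begin

type_synonym 'v graph = "'v set \<times> 'v set set"

definition simple_graph :: "'v graph \<Rightarrow> bool" where
  "simple_graph G \<longleftrightarrow> finite (fst G) \<and> (\<forall>e\<in>snd G. e \<subseteq> fst G \<and> card e = 2)"

definition v_num :: "'v graph \<Rightarrow> nat" where
  "v_num G = card (fst G)"

definition e_num :: "'v graph \<Rightarrow> nat" where
  "e_num G = card (snd G)"

definition subgraph :: "'v graph \<Rightarrow> 'v graph \<Rightarrow> bool" where
  "subgraph G H \<longleftrightarrow> simple_graph G \<and> simple_graph H \<and> fst G \<subseteq> fst H \<and> snd G \<subseteq> snd H"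

definition isomorphic :: "'v graph \<Rightarrow> 'w graph \<Rightarrow> bool" where
  "isomorphic G H \<longleftrightarrow> (\<exists>f. bij_betw f (fst G) (fst H) \<and> snd H = (\<lambda>e. f ` e) ` snd G)"

definition complete_graph :: "nat \<Rightarrow> nat graph" where
  "complete_graph n = ({..<n}, {e. e \<subseteq> {..<n} \<and> card e = 2})"

definition m2 :: "'v graph \<Rightarrow> real" where
  "m2 H = Max {(real (e_num G) - 1) / (real (v_num G) - 2) | G. subgraph G H \<and> v_num G \<ge> 3}"

type_synonym 'a hypergraph = "'a set \<times> 'a set set"

text \<open>A round consists of the element claimed by Maker and the set claimed by Breaker in reply.
  A stage is recorded as the list of its rounds in chronological order, and a play as the list of
  its completed stages.\<close>

type_synonym 'a round = "'a \<times> 'a set"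
type_synonym 'a stage = "'a round list"

definition maker_set :: "'a stage \<Rightarrow> 'a set" where
  "maker_set rs = fst ` set rs"

definition claimed :: "'a stage \<Rightarrow> 'a set" where
  "claimed rs = maker_set rs \<union> \<Union> (snd ` set rs)"

text \<open>The list may be a proper initial part of a stage. Breaker may claim fewer than \<open>b\<close> elements,
  possibly none.\<close>

definition legal_rounds :: "nat \<Rightarrow> 'a set \<Rightarrow> 'a stage \<Rightarrow> bool" where
  "legal_rounds b X rs \<longleftrightarrow>
     (\<forall>k<length rs. \<forall>x B. rs ! k = (x, B) \<longrightarrow>
        x \<in> X - claimed (take k rs) \<and>
        B \<subseteq> X - claimed (take k rs) - {x} \<and> finite B \<and> card B \<le> b)"

text \<open>\<open>after_stages\<close> yields the pair consisting of the board and the family of remaining winning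
  sets once the given stages have been completed.\<close>

definition next_hypergraph :: "'a hypergraph \<Rightarrow> 'a stage \<Rightarrow> 'a hypergraph" where
  "next_hypergraph H rs = (maker_set rs, {F \<in> snd H. F \<subseteq> maker_set rs})"

definition after_stages :: "'a hypergraph \<Rightarrow> 'a stage list \<Rightarrow> 'a hypergraph" where
  "after_stages H p = foldl next_hypergraph H p"

text \<open>A further stage is played only as long as some winning set is left.\<close>

inductive play :: "nat \<Rightarrow> 'a hypergraph \<Rightarrow> 'a stage list \<Rightarrow> bool"
  for b :: nat and H :: "'a hypergraph" where
  start: "play b H []"
| stage: "\<lbrakk>play b H p; snd (after_stages H p) \<noteq> {};
           legal_rounds b (fst (after_stages H p)) rs; claimed rs = fst (after_stages H p)\<rbrakk>
          \<Longrightarrow> play b H (p @ [rs])"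

text \<open>A strategy of Maker sees the completed stages and the completed rounds of the current stage.
  It must select an unclaimed element at every position in which Maker is to move; without this
  requirement, a strategy could ensure anything vacuously by making an illegal move.\<close>

type_synonym 'a strategy = "'a stage list \<Rightarrow> 'a stage \<Rightarrow> 'a"

definition maker_strategy :: "nat \<Rightarrow> 'a hypergraph \<Rightarrow> 'a strategy \<Rightarrow> bool" where
  "maker_strategy b H \<sigma> \<longleftrightarrow>
     (\<forall>p rs. play b H p \<and> snd (after_stages H p) \<noteq> {} \<and>
        legal_rounds b (fst (after_stages H p)) rs \<and> claimed rs \<noteq> fst (after_stages H p) \<longrightarrow>
        \<sigma> p rs \<in> fst (after_stages H p) - claimed rs)"

definition follows :: "'a strategy \<Rightarrow> 'a stage list \<Rightarrow> bool" where
  "follows \<sigma> p \<longleftrightarrow>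
     (\<forall>i<length p. \<forall>k<length (p ! i). fst (p ! i ! k) = \<sigma> (take i p) (take k (p ! i)))"

text \<open>Plays with fewer than \<open>s\<close> stages are included since the game may have stopped early; if
  \<open>s\<close> stages are reached, all earlier families of winning sets were nonempty anyway.\<close>

definition maker_ensures :: "nat \<Rightarrow> 'a hypergraph \<Rightarrow> nat \<Rightarrow> bool" where
  "maker_ensures b H s \<longleftrightarrow>
     (\<exists>\<sigma>. maker_strategy b H \<sigma> \<and>
        (\<forall>p. play b H p \<and> follows \<sigma> p \<and> length p \<le> s \<longrightarrow> snd (after_stages H p) \<noteq> {}))"

text \<open>Meaningful only if the largest such \<open>s\<close> exists. This holds for a finite hypergraph with at
  least one winning set, all of whose winning sets have at least two elements, if \<open>b \<ge> 1\<close>.\<close>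

definition threshold :: "'a hypergraph \<Rightarrow> nat \<Rightarrow> nat" where
  "threshold H b = (GREATEST s. maker_ensures b H s)"

definition copy_hypergraph :: "'v graph \<Rightarrow> nat \<Rightarrow> nat set hypergraph" where
  "copy_hypergraph H n =
     (snd (complete_graph n),
      {snd G | G. subgraph G (complete_graph n) \<and> isomorphic H G})"

definition subpolynomial :: "(nat \<Rightarrow> real) \<Rightarrow> bool" where
  "subpolynomial f \<longleftrightarrow> (\<forall>\<epsilon>>0. f \<in> o(\<lambda>n. real n powr \<epsilon>))"

end

(* Write p = (b+1)^(-s) for the density left over by s stages; p = n^(-1/m2(H)) is the critical value.

   Maker: a container argument provides exp(n^(2-1/m2(H)+o(1))) sets D of order n^2 edges each, such
   that a graph meeting every D in sufficiently many edges contains H. The sum over D of exp(-lambda |D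
   inter board|), with lambda growing by a factor (1+eta)(b+1) per stage, does not increase when
   Maker always claims an edge of maximal weight. So every D keeps almost a p-fraction of its edges,
   which is enough as long as p is polynomially larger than critical.

   Breaker: let S attain the maximum in m2(H). If p is polynomially smaller than critical, each
   further copy of S attached to a chain of overlapping copies costs a factor n^(-epsilon) in the
   expected number of chains. The Erdos-Selfridge-Beck potential loses a factor b+1 per stage, that
   is n^O(1) in total, so after s stages no chain of a certain bounded length is left. The copies
   then form clusters of bounded size, and pairing inside the clusters destroys them in boundedly
   many further stages. *)

theory Submission
  imports Defs "HOL-Library.FuncSet"
begin

section \<open>Plays and strategies\<close>

text \<open>Both halves rest on one inequality, \<open>m2_upper\<close>: a set A of at least two
  edges covering w vertices satisfies |A| - 1 \<le> m2 (w - 2). Put q = n^(-1/m2). For Maker it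
  gives n^(v - w) \<le> n^(v - 2) q^(|A| - 1), so up to constants at most n^(v - 2) q^(|A| - 1)
  copies contain given |A| edges. This is the codegree condition behind the containers. It fixes the
  fingerprint size n^2 q, and the share n^2 p outgrows n^2 q times a logarithm as soon as p / q is a
  positive power of n. For Breaker it is subtracted from the equality for S: completing a copy of S
  from a proper nonempty part costs at most n^(-epsilon). Breaker's obstacle is that single copies
  cannot be the target of the potential. At p = q the expected number of copies of S is n^(2 -
  1/m2), in general a positive power of n. Only long chains have a small expectation, and the
  isolated clusters that survive need another argument. The number of stages which that argument
  takes depends on H and epsilon alone; it disappears in the error term because a subpolynomial b
  makes log_(b+1) n tend to infinity.\<close>

lemma maker_set_Nil [simp]: "maker_set [] = {}"
  by (simp add: maker_set_def)

lemma maker_set_snoc [simp]: "maker_set (rs @ [(x, B)]) = insert x (maker_set rs)"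
  by (auto simp: maker_set_def)

lemma claimed_Nil [simp]: "claimed [] = {}"
  by (simp add: claimed_def)

lemma claimed_snoc [simp]: "claimed (rs @ [(x, B)]) = insert x (claimed rs \<union> B)"
  by (auto simp: claimed_def maker_set_def)

lemma maker_set_subset_claimed: "maker_set rs \<subseteq> claimed rs"
  by (simp add: claimed_def)

lemma legal_rounds_Nil [simp]: "legal_rounds b X []"
  by (simp add: legal_rounds_def)

lemma legal_rounds_snoc [simp]:
  "legal_rounds b X (rs @ [(x, B)]) \<longleftrightarrow>
     legal_rounds b X rs \<and> x \<in> X - claimed rs \<and>
     B \<subseteq> X - claimed rs - {x} \<and> finite B \<and> card B \<le> b"
proof -
  have "(\<forall>k<Suc (length rs). P k ((rs @ [(x, B)]) ! k) (take k (rs @ [(x, B)]))) \<longleftrightarrow>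
      (\<forall>k<length rs. P k (rs ! k) (take k rs)) \<and> P (length rs) (x, B) rs" for P
    by (auto simp: less_Suc_eq nth_append)
  from this[of "\<lambda>_ r rs. \<forall>x B. r = (x, B) \<longrightarrow> x \<in> X - claimed rs \<and>
    B \<subseteq> X - claimed rs - {x} \<and> finite B \<and> card B \<le> b"] show ?thesis
    unfolding legal_rounds_def by simp
qed

lemma claimed_subset: "legal_rounds b X rs \<Longrightarrow> claimed rs \<subseteq> X"
  by (induction rs rule: rev_induct) auto

lemma legal_rounds_append: "legal_rounds b X (rs @ rs') \<Longrightarrow> legal_rounds b X rs"
proof (induction rs' rule: rev_induct)
  case (snoc r rs')
  then show ?case
    by (cases r) (simp only: append_assoc[symmetric] legal_rounds_snoc)
qed simp

lemma legal_rounds_take: "legal_rounds b X rs \<Longrightarrow> legal_rounds b X (take k rs)"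
  by (metis append_take_drop_id legal_rounds_append)

lemma after_stages_Nil [simp]: "after_stages H [] = H"
  by (simp add: after_stages_def)

lemma after_stages_snoc:
  "after_stages H (p @ [rs]) = next_hypergraph (after_stages H p) rs"
  by (simp add: after_stages_def)

lemma fst_after_stages_snoc [simp]: "fst (after_stages H (p @ [rs])) = maker_set rs"
  by (simp add: after_stages_snoc next_hypergraph_def)

lemma board_subset: "play b H p \<Longrightarrow> fst (after_stages H p) \<subseteq> fst H"
proof (induction rule: play.induct)
  case (stage p rs)
  then show ?case
    using claimed_subset[of b _ rs] maker_set_subset_claimed[of rs] by auto
qed simp

lemma winning_sets_after_stages:
  assumes "play b H p" and "\<And>F. F \<in> snd H \<Longrightarrow> F \<subseteq> fst H"
  shows "snd (after_stages H p) = {F \<in> snd H. F \<subseteq> fst (after_stages H p)}"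
  using assms(1)
proof (induction rule: play.induct)
  case start
  then show ?case using assms(2) by auto
next
  case (stage p rs)
  have "maker_set rs \<subseteq> fst (after_stages H p)"
    using stage.hyps maker_set_subset_claimed[of rs] by auto
  then show ?case
    using stage.IH by (auto simp: after_stages_snoc next_hypergraph_def)
qed

lemma follows_Nil [simp]: "follows \<sigma> []"
  by (simp add: follows_def)

lemma follows_snoc [simp]:
  "follows \<sigma> (p @ [rs]) \<longleftrightarrow>
     follows \<sigma> p \<and> (\<forall>k<length rs. fst (rs ! k) = \<sigma> p (take k rs))"
  by (auto simp: follows_def nth_append less_Suc_eq)

lemma maker_ensures_antimono:
  "maker_ensures b H s \<Longrightarrow> t \<le> s \<Longrightarrow> maker_ensures b H t"
  unfolding maker_ensures_def by (meson order_trans)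

text \<open>Maker always takes an element that cannot raise \<Phi>, chosen by \<open>SOME\<close>.
  Since \<Phi> sees only the stage number, the board and the rounds of the current stage,
  \<open>move\<close> and \<open>finish\<close> can be checked one stage at a time, without
  histories; \<open>finish\<close> hands the value at the end of a stage over to the start of the
  next.\<close>

lemma potential_strategy:
  fixes H :: "'a hypergraph" and \<Phi> :: "nat \<Rightarrow> 'a set \<Rightarrow> 'a stage \<Rightarrow> real"
  assumes fin: "finite (fst H)"
    and move: "\<And>i X rs. i < s \<Longrightarrow> finite X \<Longrightarrow> legal_rounds b X rs \<Longrightarrow> claimed rs \<noteq> X \<Longrightarrow>
      \<exists>x\<in>X - claimed rs. \<forall>B. B \<subseteq> X - claimed rs - {x} \<and> card B \<le> b \<longrightarrow>
        \<Phi> i X (rs @ [(x, B)]) \<le> \<Phi> i X rs"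
    and finish: "\<And>i X rs. i < s \<Longrightarrow> finite X \<Longrightarrow> legal_rounds b X rs \<Longrightarrow> claimed rs = X \<Longrightarrow>
      \<Phi> (Suc i) (maker_set rs) [] \<le> \<Phi> i X rs"
  obtains \<sigma> where "maker_strategy b H \<sigma>"
    and "\<And>p. play b H p \<Longrightarrow> follows \<sigma> p \<Longrightarrow> length p \<le> s \<Longrightarrow>
      \<Phi> (length p) (fst (after_stages H p)) [] \<le> \<Phi> 0 (fst H) []"
proof -
  \<comment> \<open>From stage \<open>s\<close> on, \<open>good\<close> only asks for a legal move:
    \<open>maker_strategy\<close> requires legality in every play, whereas \<open>move\<close>
    controls \<Phi> during the first \<open>s\<close> stages only.\<close>
  define good where "good i X rs x \<longleftrightarrow> x \<in> X - claimed rs \<and>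
    (i < s \<longrightarrow> (\<forall>B. B \<subseteq> X - claimed rs - {x} \<and> card B \<le> b \<longrightarrow> \<Phi> i X (rs @ [(x, B)]) \<le> \<Phi> i X rs))"
    for i X rs x
  define \<sigma> where "\<sigma> p rs = (SOME x. good (length p) (fst (after_stages H p)) rs x)" for p rs
  have good: "good (length p) (fst (after_stages H p)) rs (\<sigma> p rs)"
    if "play b H p" "legal_rounds b (fst (after_stages H p)) rs"
      "claimed rs \<noteq> fst (after_stages H p)" for p rs
  proof -
    have "finite (fst (after_stages H p))"
      using board_subset[OF that(1)] fin finite_subset by blast
    then have "\<exists>x. good (length p) (fst (after_stages H p)) rs x"
      using move[of "length p", OF _ _ that(2,3)] claimed_subset[OF that(2)] that(3)
      unfolding good_def by (cases "length p < s") blast+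
    then show ?thesis unfolding \<sigma>_def by (rule someI_ex)
  qed
  have "maker_strategy b H \<sigma>"
    unfolding maker_strategy_def using good good_def by blast
  moreover have "\<Phi> (length p) (fst (after_stages H p)) [] \<le> \<Phi> 0 (fst H) []"
    if "play b H p" "follows \<sigma> p" "length p \<le> s" for p
    using that
  proof (induction rule: play.induct)
    case start
    then show ?case by simp
  next
    case (stage p rs)
    define X where "X = fst (after_stages H p)"
    have finX: "finite X"
      using board_subset[OF stage.hyps(1)] fin finite_subset unfolding X_def by blast
    have "\<Phi> (length p) X (take k rs) \<le> \<Phi> (length p) X []" if "k \<le> length rs" for k
      using that
    proof (induction k)
      case (Suc k)
      obtain x B where xB: "rs ! k = (x, B)" by (cases "rs ! k")
      have x: "x = \<sigma> p (take k rs)"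
        using stage.prems Suc.prems xB by (metis Suc_le_lessD follows_snoc fst_conv)
      have take: "take (Suc k) rs = take k rs @ [(x, B)]"
        using Suc.prems xB by (simp add: take_Suc_conv_app_nth)
      have leg: "legal_rounds b X (take k rs @ [(x, B)])"
        using legal_rounds_take[of b X rs "Suc k"] stage.hyps(3) take X_def by simp
      then have "good (length p) X (take k rs) x"
        using good[OF stage.hyps(1), of "take k rs"] x X_def by auto
      then have "\<Phi> (length p) X (take (Suc k) rs) \<le> \<Phi> (length p) X (take k rs)"
        using leg stage.prems unfolding take good_def by auto
      then show ?case using Suc by simp
    qed simp
    from this[of "length rs"] have "\<Phi> (length p) X rs \<le> \<Phi> (length p) X []" by simp
    moreover have "\<Phi> (Suc (length p)) (maker_set rs) [] \<le> \<Phi> (length p) X rs"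
      using finish[OF _ finX, of "length p" rs] stage.hyps stage.prems X_def by simp
    moreover have "\<Phi> (length p) X [] \<le> \<Phi> 0 (fst H) []"
      using stage.IH stage.prems X_def by simp
    ultimately show ?case by simp
  qed
  ultimately show ?thesis by (rule that)
qed

text \<open>The invariant concerns the positions in which Maker is to move, and Breaker restores it by his
  reply.\<close>

definition stage_invariant :: "nat \<Rightarrow> 'a set \<Rightarrow> ('a stage \<Rightarrow> bool) \<Rightarrow> bool" where
  "stage_invariant b X Inv \<longleftrightarrow> Inv [] \<and>
     (\<forall>rs x. legal_rounds b X rs \<and> Inv rs \<and> x \<in> X - claimed rs \<longrightarrow>
       (\<exists>B \<subseteq> X - claimed rs - {x}. card B \<le> b \<and> Inv (rs @ [(x, B)])))"

text \<open>The invariant stands in for a strategy of Breaker, so his replies need not be a function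
  of the position. \<open>Q\<close> speaks of Maker's set because this is the board of the next
  stage.\<close>

definition breaker_forces :: "nat \<Rightarrow> 'a set \<Rightarrow> ('a set \<Rightarrow> bool) \<Rightarrow> bool" where
  "breaker_forces b X Q \<longleftrightarrow> (\<exists>Inv. stage_invariant b X Inv \<and>
     (\<forall>rs. legal_rounds b X rs \<and> claimed rs = X \<and> Inv rs \<longrightarrow> Q (maker_set rs)))"

text \<open>Maker's choices \<tau> are fixed beforehand, so a single line of play has to be found.
  It grows from a position satisfying the invariant; each round uses up at least Maker's element,
  which bounds the recursion.\<close>

lemma breaker_forces_stage:
  fixes \<tau> :: "'a stage \<Rightarrow> 'a"
  assumes forces: "breaker_forces b X Q" and fin: "finite X"
    and move: "\<And>rs. legal_rounds b X rs \<Longrightarrow> claimed rs \<noteq> X \<Longrightarrow> \<tau> rs \<in> X - claimed rs"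
  obtains rs where "legal_rounds b X rs" "claimed rs = X"
    "\<And>k. k < length rs \<Longrightarrow> fst (rs ! k) = \<tau> (take k rs)" "Q (maker_set rs)"
proof -
  obtain Inv where inv: "stage_invariant b X Inv"
    and Q: "\<And>rs. legal_rounds b X rs \<Longrightarrow> claimed rs = X \<Longrightarrow> Inv rs \<Longrightarrow> Q (maker_set rs)"
    using forces unfolding breaker_forces_def by blast
  have Inv: "Inv []"
    "\<And>rs x. legal_rounds b X rs \<Longrightarrow> Inv rs \<Longrightarrow> x \<in> X - claimed rs \<Longrightarrow>
       \<exists>B \<subseteq> X - claimed rs - {x}. card B \<le> b \<and> Inv (rs @ [(x, B)])"
    using inv unfolding stage_invariant_def by simp_all
  have "\<exists>rs'. legal_rounds b X rs' \<and> claimed rs' = X \<and>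
      (\<forall>k<length rs'. fst (rs' ! k) = \<tau> (take k rs')) \<and> Inv rs'"
    if "legal_rounds b X rs" "\<forall>k<length rs. fst (rs ! k) = \<tau> (take k rs)" "Inv rs" for rs
    using that
  proof (induction "card (X - claimed rs)" arbitrary: rs rule: less_induct)
    case less
    show ?case
    proof (cases "claimed rs = X")
      case True
      then show ?thesis using less.prems by blast
    next
      case False
      define x where "x = \<tau> rs"
      have x: "x \<in> X - claimed rs" using move less.prems False x_def by blast
      obtain B where B: "B \<subseteq> X - claimed rs - {x}" "card B \<le> b" "Inv (rs @ [(x, B)])"
        using Inv(2)[OF less.prems(1,3) x] by blast
      have "finite B" using B(1) fin by (meson finite_Diff finite_subset)
      then have leg: "legal_rounds b X (rs @ [(x, B)])"
        using less.prems B x by simp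
      have "card (X - claimed (rs @ [(x, B)])) < card (X - claimed rs)"
        using x fin by (intro psubset_card_mono) auto
      moreover have "\<forall>k<length (rs @ [(x, B)]).
          fst ((rs @ [(x, B)]) ! k) = \<tau> (take k (rs @ [(x, B)]))"
        using less.prems(2) x_def by (auto simp: nth_append less_Suc_eq)
      ultimately show ?thesis using less.hyps leg B(3) by blast
    qed
  qed
  from this[of "[]"] Inv(1) obtain rs where "legal_rounds b X rs" "claimed rs = X"
    "\<forall>k<length rs. fst (rs ! k) = \<tau> (take k rs)" "Inv rs" by auto
  then show ?thesis using that Q by blast
qed

text \<open>Strings stages together, \<open>J i\<close> being the condition on the board after
  \<open>i\<close> further stages. Starting from an arbitrary play \<open>p\<close> allows one phase
  to be glued to another; the alternative of no winning set left covers plays that stop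
  early.\<close>

lemma breaker_forces_play:
  fixes H :: "'a hypergraph"
  assumes fin: "finite (fst H)" and strat: "maker_strategy b H \<sigma>"
    and start: "play b H p" "follows \<sigma> p" "J 0 (fst (after_stages H p))"
    and forces: "\<And>i X. i < t \<Longrightarrow> X \<subseteq> fst H \<Longrightarrow> J i X \<Longrightarrow> breaker_forces b X (J (Suc i))"
  obtains p' where "play b H p'" "follows \<sigma> p'" "length p' \<le> length p + t"
    "snd (after_stages H p') = {} \<or> J t (fst (after_stages H p'))"
proof -
  have "\<exists>p'. play b H p' \<and> follows \<sigma> p' \<and> length p' \<le> length p + i \<and>
      (snd (after_stages H p') = {} \<or> J i (fst (after_stages H p')))" if "i \<le> t" for i
    using that
  proof (induction i)
    case 0
    then show ?case using start by auto
  next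
    case (Suc i)
    then obtain p' where p': "play b H p'" "follows \<sigma> p'" "length p' \<le> length p + i"
      "snd (after_stages H p') = {} \<or> J i (fst (after_stages H p'))" by auto
    show ?case
    proof (cases "snd (after_stages H p') = {}")
      case True
      then show ?thesis using p' by (intro exI[of _ p']) auto
    next
      case False
      define X where "X = fst (after_stages H p')"
      have X: "X \<subseteq> fst H" using board_subset[OF p'(1)] X_def by simp
      then have "finite X" using fin finite_subset by blast
      moreover have "breaker_forces b X (J (Suc i))"
        using forces[of i X] X p'(4) False Suc.prems X_def by auto
      moreover have "\<sigma> p' rs \<in> X - claimed rs" if "legal_rounds b X rs" "claimed rs \<noteq> X" for rs
        using strat False p'(1) that unfolding maker_strategy_def X_def by blast
      ultimately obtain rs where "legal_rounds b X rs" "claimed rs = X"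
        "\<And>k. k < length rs \<Longrightarrow> fst (rs ! k) = \<sigma> p' (take k rs)" "J (Suc i) (maker_set rs)"
        using breaker_forces_stage[of b X "J (Suc i)" "\<sigma> p'"] by blast
      then show ?thesis
        using p' False by (intro exI[of _ "p' @ [rs]"]) (auto intro: play.stage simp: X_def)
    qed
  qed
  from this[of t] show ?thesis using that by auto
qed

section \<open>Maker's potential\<close>

text \<open>This bounds the effect of a reply of Breaker by a sum over its elements.\<close>

lemma power_minus_one_convex:
  fixes \<beta> :: real
  assumes "\<beta> \<ge> 1" and "k \<le> b"
  shows "real b * (\<beta> ^ k - 1) \<le> real k * (\<beta> ^ b - 1)"
  using assms(2)
proof (induction b rule: dec_induct)
  case (step b)
  have "\<beta> ^ k - 1 = (\<beta> - 1) * (\<Sum>i<k. \<beta> ^ i)" by (rule power_diff_1_eq)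
  also have "\<dots> \<le> (\<beta> - 1) * (\<Sum>i<k. \<beta> ^ b)"
    using assms(1) step by (intro mult_left_mono sum_mono power_increasing) auto
  finally have "\<beta> ^ k - 1 \<le> real k * (\<beta> ^ Suc b - \<beta> ^ b)" by (simp add: algebra_simps)
  then show ?case using step.IH by (simp add: algebra_simps)
qed simp

text \<open>Maker's element \<open>x\<close> multiplies the weight of the sets through it by
  \<alpha>, each element lost to Breaker multiplies by \<beta>. Once \<beta>^k is replaced by its
  chord on [0, b], every element of \<open>B\<close> costs at most \<open>g\<close> times the weight
  at \<open>x\<close>, because \<open>x\<close> is maximal. The whole reply costs \<beta>^b - 1
  times that weight, which the gain 1 - \<alpha> covers by \<beta>^b + \<alpha> \<le> 2.\<close>

lemma weighted_round:
  fixes u :: "'a set \<Rightarrow> real"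
  assumes "\<And>D. D \<in> \<D> \<Longrightarrow> u D \<ge> 0"
    and \<alpha>: "0 \<le> \<alpha>" "\<alpha> \<le> 1" and \<beta>: "1 \<le> \<beta>" and "\<beta> ^ b + \<alpha> \<le> 2" and "b \<ge> 1"
    and B: "finite B" "card B \<le> b"
    and max: "\<And>y. y \<in> B \<Longrightarrow>
      (\<Sum>D\<in>\<D>. u D * of_bool (y \<in> D)) \<le> (\<Sum>D\<in>\<D>. u D * of_bool (x \<in> D))"
  shows "(\<Sum>D\<in>\<D>. u D * ((if x \<in> D then \<alpha> else 1) * \<beta> ^ card (D \<inter> B))) \<le> (\<Sum>D\<in>\<D>. u D)"
proof -
  define w where "w y = (\<Sum>D\<in>\<D>. u D * of_bool (y \<in> D))" for y
  define g where "g = (\<beta> ^ b - 1) / real b"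
  have w0: "w y \<ge> 0" for y
    unfolding w_def using assms(1) by (intro sum_nonneg) auto
  have g0: "g \<ge> 0" using \<beta> by (simp add: g_def)
  \<comment> \<open>If \<open>x\<close> lies in \<open>D\<close>, the mixed term is absorbed by
    \<alpha> (\<beta>^k - 1) \<le> \<beta>^k - 1.\<close>
  have pt: "(if x \<in> D then \<alpha> else 1) * \<beta> ^ card (D \<inter> B)
      \<le> 1 - (1 - \<alpha>) * of_bool (x \<in> D) + g * (\<Sum>y\<in>B. of_bool (y \<in> D))" for D
  proof -
    have k: "card (D \<inter> B) \<le> b" using B by (meson card_mono inf_le2 le_trans)
    have pow: "\<beta> ^ card (D \<inter> B) - 1 \<le> g * real (card (D \<inter> B))"
      using power_minus_one_convex[OF \<beta> k] \<open>b \<ge> 1\<close> by (simp add: g_def field_simps)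
    have one: "\<beta> ^ card (D \<inter> B) \<ge> 1" using \<beta> by simp
    have cnt: "(\<Sum>y\<in>B. of_bool (y \<in> D)) = real (card (D \<inter> B))"
      using B(1) by (simp add: of_bool_def sum.If_cases Int_commute)
    have "\<alpha> * (\<beta> ^ card (D \<inter> B) - 1) \<le> 1 * (\<beta> ^ card (D \<inter> B) - 1)"
      using \<alpha> one by (intro mult_right_mono) auto
    then show ?thesis using pow unfolding cnt by (auto simp: algebra_simps)
  qed
  have "(\<Sum>D\<in>\<D>. u D * ((if x \<in> D then \<alpha> else 1) * \<beta> ^ card (D \<inter> B)))
      \<le> (\<Sum>D\<in>\<D>. u D * (1 - (1 - \<alpha>) * of_bool (x \<in> D) + g * (\<Sum>y\<in>B. of_bool (y \<in> D))))"
    using assms(1) pt by (intro sum_mono mult_left_mono) auto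
  also have "\<dots> = (\<Sum>D\<in>\<D>. u D) - (1 - \<alpha>) * w x + g * (\<Sum>D\<in>\<D>. \<Sum>y\<in>B. u D * of_bool (y \<in> D))"
    unfolding w_def
    by (simp add: algebra_simps sum.distrib sum_subtractf sum_distrib_left)
  also have "(\<Sum>D\<in>\<D>. \<Sum>y\<in>B. u D * of_bool (y \<in> D)) = (\<Sum>y\<in>B. w y)"
    unfolding w_def by (rule sum.swap)
  also have "\<dots> \<le> real (card B) * w x"
    using max sum_bounded_above[of B w "w x"] unfolding w_def by auto
  also have "\<dots> \<le> real b * w x" using B w0 by (intro mult_right_mono) auto
  finally have "(\<Sum>D\<in>\<D>. u D * ((if x \<in> D then \<alpha> else 1) * \<beta> ^ card (D \<inter> B)))
      \<le> (\<Sum>D\<in>\<D>. u D) - (1 - \<alpha>) * w x + g * (real b * w x)"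
    using g0 by (simp add: mult_left_mono)
  also have "g * (real b * w x) = (\<beta> ^ b - 1) * w x"
    using \<open>b \<ge> 1\<close> by (simp add: g_def)
  also have "(\<beta> ^ b - 1) * w x \<le> (1 - \<alpha>) * w x"
    using assms(5) w0 by (intro mult_right_mono) auto
  finally show ?thesis by simp
qed

text \<open>With u = b \<kappa> and -t the second exponent, the sum is at most 2 - (t - u) + u^2 +
  t^2. For growth factor b + 1 the first-order terms cancel exactly; the extra factor 1 + \<eta>
  leaves t - u = \<eta> (\<kappa> + u), and the upper bound \<eta> / 4 makes the squares smaller
  than that.\<close>

lemma exp_stage_ineq:
  fixes \<eta> \<kappa> :: real
  assumes \<eta>: "0 < \<eta>" "\<eta> \<le> 1" and \<kappa>: "0 \<le> \<kappa>" and "(real b + 1) * (1 + \<eta>) * \<kappa> \<le> \<eta> / 4"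
  shows "exp \<kappa> ^ b + exp (\<kappa> - (real b + 1) * (1 + \<eta>) * \<kappa>) \<le> 2"
proof -
  define \<kappa>' where "\<kappa>' = (real b + 1) * (1 + \<eta>) * \<kappa>"
  define u where "u = real b * \<kappa>"
  define t where "t = \<kappa>' - \<kappa>"
  have \<kappa>': "\<kappa>' \<le> \<eta> / 4" using assms \<kappa>'_def by simp
  have eq: "\<kappa>' = \<kappa> + u + \<eta> * (\<kappa> + u)" by (simp add: \<kappa>'_def u_def algebra_simps)
  have u0: "0 \<le> u" using \<kappa> by (simp add: u_def)
  have "0 \<le> \<eta> * (\<kappa> + u)" using \<eta> \<kappa> u0 by simp
  then have u: "u \<le> \<kappa>'" and t: "u \<le> t" "t \<le> \<kappa>'" using eq \<kappa> u0 t_def by auto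
  have le1: "\<kappa>' \<le> 1" "0 \<le> \<kappa>'" using \<kappa>' \<eta> u u0 by auto
  have 1: "exp u \<le> 1 + u + u\<^sup>2" using u u0 le1 by (intro exp_bound) auto
  have 2: "exp (- t) \<le> 1 - t + t\<^sup>2"
  proof -
    \<comment> \<open>The product is 1 + t^3.\<close>
    have "1 \<le> (1 + t) * (1 - t + t\<^sup>2)"
      using u0 t by (simp add: algebra_simps power2_eq_square)
    also have "\<dots> \<le> exp t * (1 - t + t\<^sup>2)"
    proof (rule mult_right_mono)
      show "0 \<le> 1 - t + t\<^sup>2" using t le1 by (simp add: add_nonneg_nonneg)
    qed (simp add: exp_ge_add_one_self)
    finally show ?thesis by (simp add: exp_minus field_simps)
  qed
  have "\<eta> * \<kappa>' \<le> 2 * (\<eta> * (\<kappa> + u))"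
  proof -
    have "\<eta> * (\<kappa> + u) \<le> 1 * (\<kappa> + u)" using \<eta> \<kappa> u0 by (intro mult_right_mono) auto
    then have "\<kappa>' \<le> 2 * (\<kappa> + u)" using eq by simp
    then have "\<eta> * \<kappa>' \<le> \<eta> * (2 * (\<kappa> + u))" using \<eta> by (intro mult_left_mono) auto
    then show ?thesis by (simp add: algebra_simps)
  qed
  moreover have "t - u = \<eta> * (\<kappa> + u)" using eq t_def by simp
  moreover have "u\<^sup>2 \<le> \<kappa>' * (\<eta> / 4)" "t\<^sup>2 \<le> \<kappa>' * (\<eta> / 4)"
    unfolding power2_eq_square using u0 u t \<kappa>' le1 by (intro mult_mono; simp)+
  ultimately have "u + u\<^sup>2 - t + t\<^sup>2 \<le> 0" by (simp add: algebra_simps)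
  then have "exp u + exp (- t) \<le> 2" using 1 2 by simp
  then show ?thesis by (simp add: u_def t_def \<kappa>'_def exp_of_nat_mult)
qed

text \<open>An exponential weight turns a lower bound for all intersections simultaneously into one
  potential: a set \<open>D\<close> that keeps too few elements would alone outweigh the initial
  sum. Only the logarithm of the number of sets is paid for.\<close>

lemma maker_keeps_fair_share:
  fixes H :: "'a hypergraph" and \<D> :: "'a set set" and \<eta> \<mu> :: real
  assumes fin: "finite (fst H)" "finite \<D>" and b: "b \<ge> 1" and \<eta>: "0 < \<eta>" "\<eta> \<le> 1"
    and sub: "\<And>D. D \<in> \<D> \<Longrightarrow> D \<subseteq> fst H" and large: "\<And>D. D \<in> \<D> \<Longrightarrow> \<mu> \<le> real (card D)"
    and \<mu>0: "0 \<le> \<mu>"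
  obtains \<sigma> where "maker_strategy b H \<sigma>"
    and "\<And>p D. play b H p \<Longrightarrow> follows \<sigma> p \<Longrightarrow> length p \<le> s \<Longrightarrow> D \<in> \<D> \<Longrightarrow>
      \<mu> / ((real b + 1) * (1 + \<eta>)) ^ s - 4 / \<eta> * ln (card \<D>)
        \<le> real (card (D \<inter> fst (after_stages H p)))"
proof -
  define R where "R = (real b + 1) * (1 + \<eta>)"
  \<comment> \<open>The last coefficient \<eta> / 4 is the largest that
    \<open>exp_stage_ineq\<close> admits as its growing term. Going back by a factor
    \<open>R\<close> per stage leaves \<eta> / (4 R^s) at the start; rescaling by 4 / \<eta>
    produces both terms of the final bound.\<close>
  define \<kappa> where "\<kappa> i = \<eta> / 4 * R ^ i / R ^ s" for i
  \<comment> \<open>Elements won in stage \<open>i\<close> already carry the coefficient of the next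
    stage, open ones that of the current stage, and Breaker's none. When nothing is open, the value
    is that of the next stage at its start.\<close>
  define val where "val i X rs D =
    exp (- (\<kappa> (Suc i) * card (D \<inter> maker_set rs) + \<kappa> i * card (D \<inter> (X - claimed rs))))"
    for i X and rs :: "'a stage" and D
  define \<Phi> where "\<Phi> i X rs = (\<Sum>D\<in>\<D>. val i X rs D)" for i X and rs :: "'a stage"
  have R1: "R \<ge> 1" using \<eta> unfolding R_def
    by (smt (verit, best) mult_le_cancel_right1 of_nat_0_le_iff)
  have \<kappa>0: "0 \<le> \<kappa> i" for i using R1 \<eta> by (simp add: \<kappa>_def)
  have \<kappa>Suc: "\<kappa> (Suc i) = R * \<kappa> i" for i by (simp add: \<kappa>_def)
  have \<kappa>le: "\<kappa> i \<le> \<eta> / 4" if "i \<le> s" for i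
  proof -
    have "R ^ i \<le> R ^ s" using R1 that by (intro power_increasing) auto
    then show ?thesis using R1 \<eta> by (simp add: \<kappa>_def field_simps)
  qed
  have finD: "finite D" if "D \<in> \<D>" for D using sub[OF that] fin finite_subset by blast
  have move: "\<exists>x\<in>X - claimed rs. \<forall>B. B \<subseteq> X - claimed rs - {x} \<and> card B \<le> b \<longrightarrow>
      \<Phi> i X (rs @ [(x, B)]) \<le> \<Phi> i X rs"
    if i: "i < s" and X: "finite X" and leg: "legal_rounds b X rs" and ne: "claimed rs \<noteq> X"
    for i X and rs :: "'a stage"
  proof -
    define U where "U = X - claimed rs"
    define w where "w y = (\<Sum>D\<in>\<D>. val i X rs D * of_bool (y \<in> D))" for y
    have "finite U" "U \<noteq> {}" using X claimed_subset[OF leg] ne U_def by auto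
    then have "Max (w ` U) \<in> w ` U" by simp
    then obtain x where x: "x \<in> U" "w x = Max (w ` U)" by auto
    have xmax: "w y \<le> w x" if "y \<in> U" for y
      unfolding x(2) using that \<open>finite U\<close> by simp
    have "\<Phi> i X (rs @ [(x, B)]) \<le> \<Phi> i X rs" if B: "B \<subseteq> U - {x}" "card B \<le> b" for B
    proof -
      have finB: "finite B" using B \<open>finite U\<close> by (meson finite_Diff finite_subset)
      have upd: "val i X (rs @ [(x, B)]) D = val i X rs D *
          ((if x \<in> D then exp (\<kappa> i - \<kappa> (Suc i)) else 1) * exp (\<kappa> i) ^ card (D \<inter> B))"
        if "D \<in> \<D>" for D
      proof -
        have xM: "x \<notin> maker_set rs" using x(1) maker_set_subset_claimed[of rs] U_def by auto
        have finM: "finite (D \<inter> maker_set rs)" using finD[OF that] by simp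
        have "D \<inter> U = (D \<inter> (U - {x} - B)) \<union> (D \<inter> {x}) \<union> (D \<inter> B)" using B x by auto
        moreover have "card \<dots> = card (D \<inter> (U - {x} - B)) + card (D \<inter> {x}) + card (D \<inter> B)"
        proof -
          have "card (D \<inter> (U - {x} - B) \<union> D \<inter> {x} \<union> D \<inter> B)
              = card (D \<inter> (U - {x} - B) \<union> D \<inter> {x}) + card (D \<inter> B)"
            using B finD[OF that] by (intro card_Un_disjoint) auto
          also have "card (D \<inter> (U - {x} - B) \<union> D \<inter> {x}) = card (D \<inter> (U - {x} - B)) + card (D \<inter> {x})"
            using finD[OF that] by (intro card_Un_disjoint) auto
          finally show ?thesis .
        qed
        ultimately have c1: "card (D \<inter> U) = card (D \<inter> (U - {x} - B)) + card (D \<inter> {x}) + card (D \<inter> B)"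
          by simp
        have c2: "card (D \<inter> insert x (maker_set rs)) = card (D \<inter> maker_set rs) + card (D \<inter> {x})"
          using finM xM by (cases "x \<in> D") auto
        have "X - insert x (claimed rs \<union> B) = U - {x} - B" by (auto simp: U_def)
        then have "val i X (rs @ [(x, B)]) D =
            exp (- (\<kappa> (Suc i) * card (D \<inter> insert x (maker_set rs)) + \<kappa> i * card (D \<inter> (U - {x} - B))))"
          by (simp add: val_def)
        also have "- (\<kappa> (Suc i) * card (D \<inter> insert x (maker_set rs)) + \<kappa> i * card (D \<inter> (U - {x} - B)))
          = - (\<kappa> (Suc i) * card (D \<inter> maker_set rs) + \<kappa> i * card (D \<inter> U))
            + (\<kappa> i - \<kappa> (Suc i)) * card (D \<inter> {x}) + card (D \<inter> B) * \<kappa> i"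
          unfolding c1 c2 by (simp add: algebra_simps)
        finally show ?thesis
          unfolding val_def U_def[symmetric] exp_add exp_of_nat_mult by (cases "x \<in> D") auto
      qed
      have "\<Phi> i X (rs @ [(x, B)]) = (\<Sum>D\<in>\<D>. val i X rs D *
          ((if x \<in> D then exp (\<kappa> i - \<kappa> (Suc i)) else 1) * exp (\<kappa> i) ^ card (D \<inter> B)))"
        unfolding \<Phi>_def using upd by (rule sum.cong[OF refl])
      also have "\<dots> \<le> (\<Sum>D\<in>\<D>. val i X rs D)"
      proof (rule weighted_round[of _ _ _ _ b])
        show "exp (\<kappa> i) ^ b + exp (\<kappa> i - \<kappa> (Suc i)) \<le> 2"
          unfolding \<kappa>Suc R_def using \<kappa>le[of "Suc i"] i \<kappa>0 \<eta>
          by (intro exp_stage_ineq) (auto simp: \<kappa>Suc R_def)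
        have "1 * \<kappa> i \<le> \<kappa> (Suc i)" unfolding \<kappa>Suc using R1 \<kappa>0 by (intro mult_right_mono) auto
        then show "exp (\<kappa> i - \<kappa> (Suc i)) \<le> 1" by simp
      qed (use B b finB \<kappa>0 xmax in \<open>auto simp: val_def w_def\<close>)
      finally show ?thesis by (simp add: \<Phi>_def)
    qed
    then show ?thesis using x(1) U_def by blast
  qed
  have finish: "\<Phi> (Suc i) (maker_set rs) [] \<le> \<Phi> i X rs"
    if "claimed rs = X" for i X and rs :: "'a stage"
    using that by (simp add: \<Phi>_def val_def)
  obtain \<sigma> where \<sigma>: "maker_strategy b H \<sigma>"
    "\<And>p. play b H p \<Longrightarrow> follows \<sigma> p \<Longrightarrow> length p \<le> s \<Longrightarrow>
      \<Phi> (length p) (fst (after_stages H p)) [] \<le> \<Phi> 0 (fst H) []"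
  proof (rule potential_strategy[of H s b \<Phi>])
    show "finite (fst H)" by (rule fin(1))
  qed (use move finish in auto)
  have "\<mu> / R ^ s - 4 / \<eta> * ln (card \<D>) \<le> real (card (D \<inter> fst (after_stages H p)))"
    if p: "play b H p" "follows \<sigma> p" "length p \<le> s" and D: "D \<in> \<D>" for p D
  proof -
    define X where "X = fst (after_stages H p)"
    define N where "N = card (D \<inter> X)"
    have N1: "real (card \<D>) \<ge> 1" using D fin(2) by (metis One_nat_def Suc_leI card_gt_0_iff
          empty_iff of_nat_1 of_nat_le_iff)
    \<comment> \<open>A single summand is bounded by the whole sum, and this by its initial
      value.\<close>
    have "exp (- (\<kappa> (length p) * N)) = val (length p) X [] D" by (simp add: val_def N_def)
    also have "\<dots> \<le> \<Phi> (length p) X []"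
      unfolding \<Phi>_def using fin(2) D by (intro member_le_sum) (auto simp: val_def)
    also have "\<dots> \<le> \<Phi> 0 (fst H) []" using \<sigma>(2) p X_def by simp
    also have "\<dots> \<le> (\<Sum>D\<in>\<D>. exp (- (\<kappa> 0 * \<mu>)))"
      unfolding \<Phi>_def val_def using large sub \<kappa>0
      by (intro sum_mono) (auto simp: Int_absorb2 intro: mult_left_mono)
    also have "\<dots> = exp (ln (card \<D>) - \<kappa> 0 * \<mu>)" using N1 by (simp add: exp_diff exp_minus divide_inverse)
    finally have "\<kappa> 0 * \<mu> - ln (card \<D>) \<le> \<kappa> (length p) * N" by simp
    also have "\<dots> \<le> \<eta> / 4 * N" using \<kappa>le[OF p(3)] by (intro mult_right_mono) auto
    finally have "4 / \<eta> * (\<kappa> 0 * \<mu> - ln (card \<D>)) \<le> 4 / \<eta> * (\<eta> / 4 * N)"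
      using \<eta> by (intro mult_left_mono) auto
    moreover have "4 / \<eta> * (\<kappa> 0 * \<mu> - ln (card \<D>)) = \<mu> / R ^ s - 4 / \<eta> * ln (card \<D>)"
      using \<eta> by (simp add: \<kappa>_def right_diff_distrib)
    ultimately show ?thesis using \<eta> by (simp add: N_def X_def)
  qed
  then show ?thesis using that \<sigma>(1) unfolding R_def by blast
qed

section \<open>Containers\<close>

text \<open>The elements of a copy are numbered, so a partial copy is described by a set of
  positions. The index \<open>f\<close> is kept apart from its element set; for graphs it will be an
  embedding, and several of them may have the same image.\<close>

definition agree :: "('f \<Rightarrow> nat \<Rightarrow> 'x) \<Rightarrow> nat set \<Rightarrow> 'f \<Rightarrow> 'f \<Rightarrow> bool" where
  "agree el A f g \<longleftrightarrow> (\<forall>i\<in>A. el f i = el g i)"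

text \<open>The codegree condition of the container method, with \<open>q\<close> the density of a
  fingerprint. For singletons it bounds the degrees by \<open>c * q\<close>, the quantity that
  \<Lambda> later compares with the average degree.\<close>

definition spread :: "('f \<Rightarrow> nat \<Rightarrow> 'x) \<Rightarrow> nat set \<Rightarrow> real \<Rightarrow> real \<Rightarrow> 'f set \<Rightarrow> bool" where
  "spread el I c q L \<longleftrightarrow>
     (\<forall>A\<subseteq>I. A \<noteq> {} \<longrightarrow> (\<forall>f\<in>L. real (card {g \<in> L. agree el A f g}) \<le> c * q ^ card A))"

lemma spreadD:
  "spread el I c q L \<Longrightarrow> A \<subseteq> I \<Longrightarrow> A \<noteq> {} \<Longrightarrow> f \<in> L \<Longrightarrow>
    real (card {g \<in> L. agree el A f g}) \<le> c * q ^ card A"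
  by (simp add: spread_def)

lemma agree_sym: "agree el A f g \<longleftrightarrow> agree el A g f"
  by (auto simp: agree_def)

text \<open>Elements of \<open>L\<close> are copies whose positions below \<open>j\<close> already lie inside Maker's board.
  \<open>avail\<close> discards the copies extending a saturated partial assignment of the positions above \<open>j\<close>,
  so that the codegrees of \<open>grow\<close> stay bounded. The set \<open>heavy\<close> depends on the board only through
  the few elements processed by \<open>grow\<close>, hence there are few such sets.\<close>

locale container_level =
  fixes el :: "'f \<Rightarrow> nat \<Rightarrow> 'x" and j r :: nat and q c :: real and V :: "'x set"
    and M :: real and L :: "'f set"
begin

text \<open>The factor is chosen so that each of the at most 2^r position sets saturates no more
  than M / 2^(r + 2) copies, hence M / 4 in total.\<close>

definition cap :: real where
  "cap = 2 ^ (r + 2) * q * c"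

definition avail :: "'f set \<Rightarrow> 'f set" where
  "avail L' = {f \<in> L. \<forall>A\<subseteq>{Suc j..<r}. A \<noteq> {} \<longrightarrow>
     real (card {g \<in> L'. agree el A f g}) \<le> cap * q ^ card A}"

definition link :: "'f set \<Rightarrow> 'x \<Rightarrow> 'f set" where
  "link L' x = {f \<in> avail L'. el f j = x}"

definition grow :: "'x list \<Rightarrow> 'f set" where
  "grow xs = foldl (\<lambda>L' x. L' \<union> link L' x) {} xs"

text \<open>The threshold is a quarter of the average link that \<open>M\<close> copies would have,
  so all light links together contain at most M / 4 copies.\<close>

definition heavy :: "'f set \<Rightarrow> 'x set" where
  "heavy L' = {x \<in> V. M / (4 * card V) \<le> real (card (link L' x))}"

lemma avail_subset: "avail L' \<subseteq> L"
  by (simp add: avail_def)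

lemma availD:
  "f \<in> avail L' \<Longrightarrow> A \<subseteq> {Suc j..<r} \<Longrightarrow> A \<noteq> {} \<Longrightarrow>
    real (card {g \<in> L'. agree el A f g}) \<le> cap * q ^ card A"
  by (simp add: avail_def)

lemma linkD: "f \<in> link L' x \<Longrightarrow> f \<in> avail L' \<and> f \<in> L \<and> el f j = x"
  using avail_subset by (auto simp: link_def)

lemma grow_Nil [simp]: "grow [] = {}"
  by (simp add: grow_def)

lemma grow_snoc [simp]: "grow (xs @ [x]) = grow xs \<union> link (grow xs) x"
  by (simp add: grow_def)

lemma grow_subset: "grow xs \<subseteq> L"
  by (induction xs rule: rev_induct) (auto simp: link_def avail_def)

lemma el_grow: "f \<in> grow xs \<Longrightarrow> el f j \<in> set xs"
  by (induction xs rule: rev_induct) (auto simp: link_def)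

end

locale spread_level = container_level el j r q c V M L
  for el :: "'f \<Rightarrow> nat \<Rightarrow> 'x" and j r q c V M L +
  fixes \<Lambda> :: real
  assumes finL: "finite L" and finV: "finite V" and q0: "0 < q" and c0: "0 < c" and M0: "0 < M"
    and jr: "j < r" and elV: "\<And>f. f \<in> L \<Longrightarrow> el f j \<in> V"
    and spr: "spread el {j..<r} c q L" and cardL: "M \<le> real (card L)"
    and \<Lambda>: "c * q * card V \<le> \<Lambda> * M"
begin

text \<open>Pairs of a copy saturated at \<open>A\<close> and a member of \<open>L'\<close> agreeing
  with it on \<open>A\<close> are counted twice: from the saturated side there are more than
  \<open>cap * q ^ card A\<close> for each copy, from the side of \<open>L'\<close> the spread of
  \<open>L\<close> allows at most \<open>c * q ^ card A\<close>.\<close>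

lemma card_saturated:
  assumes "L' \<subseteq> L" and small: "real (card L') \<le> q * M"
  shows "real (card (L - avail L')) \<le> M / 4"
proof -
  define bad where
    "bad A = {f \<in> L. cap * q ^ card A < real (card {g \<in> L'. agree el A f g})}" for A
  define \<A> where "\<A> = {A. A \<subseteq> {Suc j..<r} \<and> A \<noteq> {}}"
  have finL': "finite L'" using assms(1) finL finite_subset by blast
  have bad: "real (card (bad A)) \<le> M / 2 ^ (r + 2)" if "A \<in> \<A>" for A
  proof -
    have A: "A \<subseteq> {j..<r}" "A \<noteq> {}" using that by (auto simp: \<A>_def)
    have finb: "finite (bad A)" using finL by (simp add: bad_def)
    have "card (bad A) * (cap * q ^ card A)
        \<le> (\<Sum>f\<in>bad A. real (card {g \<in> L'. agree el A f g}))"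
      by (rule sum_bounded_below) (simp add: bad_def)
    also have "\<dots> = real (\<Sum>f\<in>bad A. card {g \<in> L'. agree el A f g})" by simp
    also have "(\<Sum>f\<in>bad A. card {g \<in> L'. agree el A f g})
        = (\<Sum>g\<in>L'. card {f \<in> bad A. agree el A f g})"
    proof -
      have card: "card {y \<in> Y. P y} = (\<Sum>y\<in>Y. of_bool (P y))" if "finite Y"
        for P :: "'f \<Rightarrow> bool" and Y
        using that by (simp add: of_bool_def sum.If_cases Int_def)
      show ?thesis unfolding card[OF finb] card[OF finL'] by (rule sum.swap)
    qed
    also have "real \<dots> = (\<Sum>g\<in>L'. real (card {f \<in> bad A. agree el A f g}))" by simp
    also have "\<dots> \<le> real (card L') * (c * q ^ card A)"
    proof (rule sum_bounded_above)
      fix g assume "g \<in> L'"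
      then have "real (card {f \<in> L. agree el A g f}) \<le> c * q ^ card A"
        using spreadD[OF spr A] assms(1) by blast
      moreover have "card {f \<in> bad A. agree el A f g} \<le> card {f \<in> L. agree el A g f}"
        using finL by (intro card_mono) (auto simp: bad_def agree_sym)
      ultimately show "real (card {f \<in> bad A. agree el A f g}) \<le> c * q ^ card A" by linarith
    qed
    also have "\<dots> \<le> (q * M) * (c * q ^ card A)"
      using small c0 q0 by (intro mult_right_mono) auto
    finally have "(card (bad A) * 2 ^ (r + 2)) * (q * c * q ^ card A) \<le> M * (q * c * q ^ card A)"
      by (simp add: cap_def algebra_simps)
    then have "card (bad A) * 2 ^ (r + 2) \<le> M" using q0 c0 by simp
    then show ?thesis by (simp add: field_simps)
  qed
  have fin\<A>: "finite \<A>" by (rule finite_subset[of _ "Pow {Suc j..<r}"]) (auto simp: \<A>_def)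
  have "card \<A> \<le> card (Pow {Suc j..<r})" by (rule card_mono) (auto simp: \<A>_def)
  also have "\<dots> = 2 ^ (r - Suc j)" by (simp add: card_Pow)
  also have "\<dots> \<le> (2::nat) ^ r" by (rule power_increasing) auto
  finally have card\<A>: "real (card \<A>) \<le> 2 ^ r"
    by (metis of_nat_le_iff of_nat_numeral of_nat_power)
  have "L - avail L' \<subseteq> (\<Union>A\<in>\<A>. bad A)"
  proof
    fix f assume "f \<in> L - avail L'"
    then obtain A where "A \<subseteq> {Suc j..<r}" "A \<noteq> {}"
      "\<not> real (card {g \<in> L'. agree el A f g}) \<le> cap * q ^ card A" "f \<in> L"
      unfolding avail_def by blast
    then have "A \<in> \<A>" "f \<in> bad A" by (simp_all add: \<A>_def bad_def)
    then show "f \<in> (\<Union>A\<in>\<A>. bad A)" by blast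
  qed
  then have "card (L - avail L') \<le> card (\<Union>A\<in>\<A>. bad A)"
    using fin\<A> finL by (intro card_mono) (auto simp: bad_def)
  also have "\<dots> \<le> (\<Sum>A\<in>\<A>. card (bad A))" using fin\<A> by (rule card_UN_le)
  finally have "real (card (L - avail L')) \<le> (\<Sum>A\<in>\<A>. real (card (bad A)))"
    by (metis of_nat_le_iff of_nat_sum)
  also have "\<dots> \<le> card \<A> * (M / 2 ^ (r + 2))" using bad by (rule sum_bounded_above)
  also have "\<dots> \<le> 2 ^ r * (M / 2 ^ (r + 2))"
    using card\<A> M0 by (intro mult_right_mono) auto
  also have "\<dots> = M / 4" by simp
  finally show ?thesis .
qed

lemma card_link_le: "real (card (link L' x)) \<le> c * q"
proof (cases "link L' x = {}")
  case False
  then obtain g where g: "g \<in> link L' x" by blast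
  then have "real (card {f \<in> L. agree el {j} g f}) \<le> c * q ^ card {j}"
    using jr linkD[OF g] by (intro spreadD[OF spr]) auto
  moreover have "card (link L' x) \<le> card {f \<in> L. agree el {j} g f}"
    using finL linkD[OF g] linkD[of _ L' x] by (intro card_mono) (auto simp: agree_def)
  ultimately show ?thesis by simp
qed (use c0 q0 in simp)

text \<open>At least 3 M / 4 copies are available and light elements carry at most M / 4 of them.
  The remaining M / 2 sit on heavy elements, each carrying at most \<open>c * q\<close>, and
  \<Lambda> converts the quotient into a fraction of \<open>V\<close>.\<close>

lemma card_heavy_ge:
  assumes "L' \<subseteq> L" and "real (card L') \<le> q * M"
  shows "real (card V) / (2 * \<Lambda>) \<le> real (card (heavy L'))"
proof -
  have "L \<noteq> {}" using cardL M0 by auto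
  then have N0: "0 < real (card V)" using elV finV card_gt_0_iff by fastforce
  then have "0 < c * q * card V" using c0 q0 by simp
  then have "0 < \<Lambda> * M" using \<Lambda> by linarith
  then have \<Lambda>0: "0 < \<Lambda>" using M0 by (simp add: zero_less_mult_iff)
  have fina: "finite (avail L')" using finL by (simp add: avail_def)
  have "card L = card (avail L') + card (L - avail L')"
    using finL fina by (subst card_Un_disjoint[symmetric]) (auto simp: avail_def intro!: arg_cong[of _ _ card])
  then have av: "3 * M / 4 \<le> real (card (avail L'))"
    using card_saturated[OF assms] cardL by linarith
  have "(\<Sum>x\<in>V. \<Sum>f | f \<in> avail L' \<and> el f j = x. 1::real) = (\<Sum>f\<in>avail L'. 1)"
    using fina finV elV by (intro sum.group) (auto simp: avail_def)
  then have "real (card (avail L')) = (\<Sum>x\<in>V. real (card (link L' x)))"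
    by (simp add: link_def)
  also have "\<dots> \<le> (\<Sum>x\<in>V. c * q * of_bool (x \<in> heavy L') + M / (4 * card V))"
  proof (rule sum_mono)
    fix x assume "x \<in> V"
    then show "real (card (link L' x)) \<le> c * q * of_bool (x \<in> heavy L') + M / (4 * card V)"
      using card_link_le[of L' x] M0 by (cases "x \<in> heavy L'") (auto simp: heavy_def add_increasing2)
  qed
  also have "\<dots> = c * q * (\<Sum>x\<in>V. of_bool (x \<in> heavy L')) + M / 4"
    using N0 by (simp add: sum.distrib sum_distrib_left)
  also have "(\<Sum>x\<in>V. of_bool (x \<in> heavy L')) = real (card (heavy L'))"
    using finV by (simp add: of_bool_def sum.If_cases heavy_def Int_def)
  finally have *: "M / 2 \<le> c * q * card (heavy L')" using av by linarith
  have "c * q * card V \<le> \<Lambda> * (2 * (c * q * card (heavy L')))"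
    using \<Lambda> * \<Lambda>0 by (smt (verit) mult_left_mono field_sum_of_halves)
  then have "(c * q) * card V \<le> (c * q) * (2 * \<Lambda> * card (heavy L'))" by (simp add: algebra_simps)
  then have "card V \<le> 2 * \<Lambda> * card (heavy L')" using c0 q0 by simp
  then show ?thesis using \<Lambda>0 by (simp add: field_simps)
qed

text \<open>Adding a link changes the count at \<open>f\<close> only if some new \<open>h\<close>
  agrees with \<open>f\<close> on \<open>A\<close>. Being available, \<open>h\<close> agrees with at
  most \<open>cap * q ^ card A\<close> old copies. All new ones share position \<open>j\<close> with
  \<open>h\<close>, so the spread of \<open>L\<close> at \<open>insert j A\<close> gives the
  additional factor \<open>q\<close>.\<close>

lemma spread_grow_snoc:
  assumes spread: "spread el {Suc j..<r} (cap + q * c) q (grow xs)"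
  shows "spread el {Suc j..<r} (cap + q * c) q (grow (xs @ [x]))"
  unfolding spread_def
proof (intro allI impI ballI)
  fix A f
  assume A: "A \<subseteq> {Suc j..<r}" "A \<noteq> {}" and f: "f \<in> grow (xs @ [x])"
  show "real (card {g \<in> grow (xs @ [x]). agree el A f g}) \<le> (cap + q * c) * q ^ card A"
  proof (cases "\<exists>g\<in>link (grow xs) x. agree el A f g")
    case False
    then have "f \<in> grow xs" using f by (auto simp: agree_def)
    moreover have "{g \<in> grow (xs @ [x]). agree el A f g} = {g \<in> grow xs. agree el A f g}"
      using False by auto
    ultimately show ?thesis using spreadD[OF spread A] by simp
  next
    case True
    then obtain h where h: "h \<in> link (grow xs) x" "agree el A f h" by blast
    have finA: "finite A" using A finite_subset by blast
    have fin: "finite {g \<in> grow xs. agree el A h g}"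
      using finite_subset[OF grow_subset finL] by simp
    have 1: "real (card {g \<in> grow xs. agree el A h g}) \<le> cap * q ^ card A"
      using linkD[OF h(1)] A by (intro availD) auto
    have "real (card {g \<in> L. agree el (insert j A) h g}) \<le> c * q ^ card (insert j A)"
      using linkD[OF h(1)] A jr by (intro spreadD[OF spr]) auto
    also have "card (insert j A) = Suc (card A)" using A finA by (subst card_insert_disjoint) auto
    finally have 2: "real (card {g \<in> L. agree el (insert j A) h g}) \<le> q * c * q ^ card A"
      by (simp add: mult_ac)
    have "g \<in> {g \<in> grow xs. agree el A h g} \<union> {g \<in> L. agree el (insert j A) h g}"
      if g: "g \<in> grow (xs @ [x])" "agree el A f g" for g
    proof -
      have "agree el A h g" using h(2) g(2) by (simp add: agree_def)
      then show ?thesis using g(1) linkD[of g] linkD[OF h(1)] by (auto simp: agree_def)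
    qed
    then have "card {g \<in> grow (xs @ [x]). agree el A f g}
        \<le> card ({g \<in> grow xs. agree el A h g} \<union> {g \<in> L. agree el (insert j A) h g})"
      using fin finL by (intro card_mono) auto
    also have "\<dots> \<le> card {g \<in> grow xs. agree el A h g} + card {g \<in> L. agree el (insert j A) h g}"
      by (rule card_Un_le)
    finally show ?thesis using 1 2 by (simp add: algebra_simps)
  qed
qed

text \<open>While fewer than q M copies are collected, the heavy set is large, so by hypothesis the
  board meets it in more than \<open>m\<close> elements and offers one not yet processed. Each such
  element adds M / (4 |V|) copies; \<open>m \<ge> 4 * q * card V\<close> of them reach q M.\<close>

lemma level_step:
  assumes m: "4 * q * card V \<le> real m"
    and X: "\<And>xs. set xs \<subseteq> V \<Longrightarrow> length xs \<le> m \<Longrightarrow>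
      real (card V) / (2 * \<Lambda>) \<le> real (card (heavy (grow xs))) \<Longrightarrow> m < card (X \<inter> heavy (grow xs))"
  obtains xs where "set xs \<subseteq> V" "set xs \<subseteq> X" "length xs \<le> m" "q * M \<le> real (card (grow xs))"
    "spread el {Suc j..<r} (cap + q * c) q (grow xs)"
proof -
  have "\<exists>xs. set xs \<subseteq> V \<inter> X \<and> length xs \<le> t \<and> spread el {Suc j..<r} (cap + q * c) q (grow xs) \<and>
      (q * M \<le> real (card (grow xs)) \<or>
       real t * (M / (4 * card V)) \<le> real (card (grow xs)))" if "t \<le> m" for t
    using that
  proof (induction t)
    case 0
    then show ?case by (intro exI[of _ "[]"]) (simp add: spread_def)
  next
    case (Suc t)
    then obtain xs where xs: "set xs \<subseteq> V \<inter> X" "length xs \<le> t"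
      "spread el {Suc j..<r} (cap + q * c) q (grow xs)"
      "q * M \<le> real (card (grow xs)) \<or> real t * (M / (4 * card V)) \<le> real (card (grow xs))"
      by auto
    show ?case
    proof (cases "q * M \<le> real (card (grow xs))")
      case True
      then show ?thesis using xs by (intro exI[of _ xs]) auto
    next
      case False
      then have "real (card V) / (2 * \<Lambda>) \<le> real (card (heavy (grow xs)))"
        using grow_subset by (intro card_heavy_ge) auto
      then have "m < card (X \<inter> heavy (grow xs))" using xs Suc.prems by (intro X) auto
      moreover have "card (set xs) \<le> m" using xs(2) Suc.prems card_length[of xs] by linarith
      ultimately have "\<not> X \<inter> heavy (grow xs) \<subseteq> set xs"
        using card_mono[of "set xs" "X \<inter> heavy (grow xs)"] by auto
      then obtain x where x: "x \<in> X" "x \<in> heavy (grow xs)" "x \<notin> set xs" by blast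
      \<comment> \<open>Copies collected before have their element at position \<open>j\<close> in
        \<open>xs\<close>, so a fresh \<open>x\<close> contributes only new copies.\<close>
      have "grow xs \<inter> link (grow xs) x = {}"
        using x(3) el_grow by (auto simp: link_def)
      moreover have "finite (grow xs)" using finite_subset[OF grow_subset finL] .
      moreover have "finite (link (grow xs) x)"
        using linkD by (intro finite_subset[OF _ finL]) blast
      ultimately have "card (grow (xs @ [x])) = card (grow xs) + card (link (grow xs) x)"
        by (simp add: card_Un_disjoint)
      then have "real (Suc t) * (M / (4 * card V)) \<le> real (card (grow (xs @ [x])))"
      proof -
        define \<theta> where "\<theta> = M / (4 * card V)"
        have "real t * \<theta> \<le> real (card (grow xs))" using xs(4) False by (simp add: \<theta>_def)
        moreover have "\<theta> \<le> real (card (link (grow xs) x))"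
          using x(2) by (simp add: heavy_def \<theta>_def)
        moreover have "real (Suc t) * \<theta> = real t * \<theta> + \<theta>" by (simp add: algebra_simps)
        ultimately show ?thesis
          unfolding \<open>card (grow (xs @ [x])) = _\<close> \<theta>_def[symmetric] by linarith
      qed
      then show ?thesis
        using xs x spread_grow_snoc[OF xs(3), of x]
        by (intro exI[of _ "xs @ [x]"]) (auto simp: heavy_def)
    qed
  qed
  from this[of m] obtain xs where xs: "set xs \<subseteq> V \<inter> X" "length xs \<le> m"
    "spread el {Suc j..<r} (cap + q * c) q (grow xs)"
    "q * M \<le> real (card (grow xs)) \<or> real m * (M / (4 * card V)) \<le> real (card (grow xs))"
    by auto
  have "L \<noteq> {}" using cardL M0 by auto
  then have N0: "0 < real (card V)" using elV finV card_gt_0_iff by fastforce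
  have "q * M = (4 * q * card V) * (M / (4 * card V))" using N0 by simp
  also have "\<dots> \<le> real m * (M / (4 * card V))" using m M0 N0 by (intro mult_right_mono) auto
  finally have "q * M \<le> real (card (grow xs))" using xs(4) by linarith
  then show ?thesis using that xs by auto
qed

end

lemma card_lists_le:
  assumes "finite V"
  shows "finite {xs. set xs \<subseteq> V \<and> length xs \<le> m}"
    and "card {xs. set xs \<subseteq> V \<and> length xs \<le> m} \<le> (card V + 1) ^ m"
proof -
  show "finite {xs. set xs \<subseteq> V \<and> length xs \<le> m}" by (rule finite_lists_length_le[OF assms])
  have "(\<Sum>i\<le>m. N ^ i) \<le> (N + 1) ^ m" for N :: nat
  proof (induction m)
    case (Suc m)
    have "N * N ^ m \<le> N * (N + 1) ^ m" by (intro mult_left_mono power_mono) auto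
    with Suc have "(\<Sum>i\<le>m. N ^ i) + N * N ^ m \<le> (N + 1) ^ m + N * (N + 1) ^ m"
      by (rule add_mono)
    then show ?case by simp
  qed simp
  then show "card {xs. set xs \<subseteq> V \<and> length xs \<le> m} \<le> (card V + 1) ^ m"
    using card_lists_length_le[OF assms, of m] by simp
qed

text \<open>One position is fixed per level. The guaranteed number of copies drops by the factor
  \<open>q\<close>, the spread constant changes by \<open>K * q\<close>, and thus \<Lambda> worsens
  by \<open>K\<close> only. After \<open>r\<close> levels the collection is still nonempty, and its
  members lie entirely in \<open>X\<close>.\<close>

theorem container_family:
  fixes el :: "'f \<Rightarrow> nat \<Rightarrow> 'x" and q c \<Lambda> :: real
  assumes fin: "finite \<Omega>" "finite V" and \<Omega>: "\<Omega> \<noteq> {}"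
    and elV: "\<And>f i. f \<in> \<Omega> \<Longrightarrow> i < r \<Longrightarrow> el f i \<in> V"
    and spr: "spread el {0..<r} c q \<Omega>" and q: "0 < q" and c: "0 < c"
    and \<Lambda>: "c * q * card V \<le> \<Lambda> * card \<Omega>" and m: "4 * q * card V \<le> real m"
  obtains \<D> where "finite \<D>" "real (card \<D>) \<le> real r * ((card V + 1) ^ m) ^ r"
    "\<And>D. D \<in> \<D> \<Longrightarrow> D \<subseteq> V"
    "\<And>D. D \<in> \<D> \<Longrightarrow> real (card V) / (2 * (2 ^ (r + 2) + 1) ^ r * \<Lambda>) \<le> real (card D)"
    "\<forall>X. (\<forall>D\<in>\<D>. m < card (X \<inter> D)) \<longrightarrow> (\<exists>f\<in>\<Omega>. \<forall>i<r. el f i \<in> X)"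
proof -
  \<comment> \<open>Chosen to make \<open>cap + q * cc j\<close> equal to
    \<open>cc (Suc j)\<close>.\<close>
  define K :: real where "K = 2 ^ (r + 2) + 1"
  define cc where "cc j = c * (K * q) ^ j" for j
  define MM where "MM j = card \<Omega> * q ^ j" for j
  define gr where "gr j L xs = container_level.grow el j r q (cc j) L xs" for j L xs
  define hv where "hv j L xs = container_level.heavy el j r q (cc j) V (MM j) L (gr j L xs)"
    for j L xs
  define W where "W = {xs. set xs \<subseteq> V \<and> length xs \<le> m}"
  \<comment> \<open>All collections that any board could produce. Each is determined by its list of
    processed elements at every level, which is why there are few, and none depends on
    \<open>X\<close>.\<close>
  define S where "S = rec_nat {\<Omega>} (\<lambda>j S. (\<lambda>(L, xs). gr j L xs) ` (S \<times> W))"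
  have S0: "S 0 = {\<Omega>}" and SSuc: "S (Suc j) = (\<lambda>(L, xs). gr j L xs) ` (S j \<times> W)" for j
    by (simp_all add: S_def)
  define \<D>0 where "\<D>0 = (\<Union>j<r. (\<lambda>(L, xs). hv j L xs) ` (S j \<times> W))"
  \<comment> \<open>Lists that no run produces may have small heavy sets; these are discarded. Those
    of an actual run pass the filter since \<open>K ^ j\<close> is at most
    \<open>K ^ r\<close>.\<close>
  define \<D> where "\<D> = {D \<in> \<D>0. real (card V) / (2 * K ^ r * \<Lambda>) \<le> real (card D)}"
  have finW: "finite W" and cardW: "card W \<le> (card V + 1) ^ m"
    unfolding W_def using card_lists_le[OF fin(2)] by auto
  have finS: "finite (S j) \<and> card (S j) \<le> ((card V + 1) ^ m) ^ j" for j
  proof (induction j)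
    case (Suc j)
    have "card (S (Suc j)) \<le> card (S j \<times> W)"
      unfolding SSuc using Suc finW by (intro card_image_le) auto
    also have "\<dots> \<le> ((card V + 1) ^ m) ^ j * (card V + 1) ^ m"
      unfolding card_cartesian_product using Suc cardW by (intro mult_mono) auto
    finally show ?case using Suc finW by (simp add: SSuc mult.commute)
  qed (simp add: S0)
  have fin\<D>0: "finite \<D>0" unfolding \<D>0_def using finS finW by auto
  have "card \<D>0 \<le> (\<Sum>j<r. card ((\<lambda>(L, xs). hv j L xs) ` (S j \<times> W)))"
    unfolding \<D>0_def by (rule card_UN_le) simp
  also have "\<dots> \<le> (\<Sum>j<r. ((card V + 1) ^ m) ^ r)"
  proof (rule sum_mono)
    fix j assume j: "j \<in> {..<r}"
    have "card ((\<lambda>(L, xs). hv j L xs) ` (S j \<times> W)) \<le> card (S j \<times> W)"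
      using finS finW by (intro card_image_le) auto
    also have "\<dots> \<le> ((card V + 1) ^ m) ^ j * (card V + 1) ^ m"
      unfolding card_cartesian_product using finS cardW by (intro mult_mono) auto
    also have "\<dots> = ((card V + 1) ^ m) ^ Suc j" by simp
    also have "\<dots> \<le> ((card V + 1) ^ m) ^ r" using j by (intro power_increasing) auto
    finally show "card ((\<lambda>(L, xs). hv j L xs) ` (S j \<times> W)) \<le> ((card V + 1) ^ m) ^ r" .
  qed
  finally have "card \<D>0 \<le> r * ((card V + 1) ^ m) ^ r" by simp
  moreover have "card \<D> \<le> card \<D>0" using fin\<D>0 by (intro card_mono) (auto simp: \<D>_def)
  ultimately have "card \<D> \<le> r * ((card V + 1) ^ m) ^ r" by linarith
  then have card\<D>: "real (card \<D>) \<le> real r * ((card V + 1) ^ m) ^ r"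
    by (metis of_nat_le_iff of_nat_mult)
  have N0: "0 < card \<Omega>" using \<Omega> fin by (simp add: card_gt_0_iff)
  have \<Lambda>0: "0 \<le> \<Lambda>"
  proof -
    have "0 \<le> c * q * card V" using c q by simp
    then have "0 \<le> \<Lambda> * card \<Omega>" using \<Lambda> by linarith
    then show ?thesis using N0 by (simp add: zero_le_mult_iff)
  qed
  have K1: "1 \<le> K" by (simp add: K_def)
  have \<D>V: "D \<subseteq> V" if "D \<in> \<D>" for D
    using that by (auto simp: \<D>_def \<D>0_def hv_def container_level.heavy_def)
  have main: "\<exists>f\<in>\<Omega>. \<forall>i<r. el f i \<in> X" if X: "\<And>D. D \<in> \<D> \<Longrightarrow> m < card (X \<inter> D)" for X
  proof -
    have "\<exists>L\<in>S j. L \<subseteq> \<Omega> \<and> MM j \<le> real (card L) \<and> spread el {j..<r} (cc j) q L \<and>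
        (\<forall>f\<in>L. \<forall>i<j. el f i \<in> X)" if "j \<le> r" for j
      using that
    proof (induction j)
      case 0
      then show ?case using spr by (simp add: S0 MM_def cc_def)
    next
      case (Suc j)
      then obtain L where L: "L \<in> S j" "L \<subseteq> \<Omega>" "MM j \<le> real (card L)"
        "spread el {j..<r} (cc j) q L" "\<forall>f\<in>L. \<forall>i<j. el f i \<in> X" by auto
      have \<Lambda>j: "cc j * q * card V \<le> (K ^ j * \<Lambda>) * MM j"
        using mult_left_mono[OF \<Lambda>, of "(K * q) ^ j"] K1 q
        by (simp add: cc_def MM_def algebra_simps)
      interpret spread_level el j r q "cc j" V "MM j" L "K ^ j * \<Lambda>"
      proof unfold_locales
        show "finite L" using L(2) fin(1) by (rule finite_subset)
        show "0 < cc j" using q c K1 by (simp add: cc_def)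
        show "0 < MM j" using q N0 by (simp add: MM_def)
        show "j < r" using Suc.prems by simp
        show "el f j \<in> V" if "f \<in> L" for f using that L(2) elV Suc.prems by auto
        show "spread el {j..<r} (cc j) q L" by (rule L(4))
        show "MM j \<le> real (card L)" by (rule L(3))
        show "cc j * q * card V \<le> K ^ j * \<Lambda> * MM j" by (rule \<Lambda>j)
        show "finite V" by (rule fin(2))
        show "0 < q" by (rule q)
      qed
      have "\<exists>xs. set xs \<subseteq> V \<and> set xs \<subseteq> X \<and> length xs \<le> m \<and> q * MM j \<le> real (card (grow xs)) \<and>
          spread el {Suc j..<r} (cap + q * cc j) q (grow xs)"
      proof (rule level_step[OF m, of X])
        fix xs
        assume xs: "set xs \<subseteq> V" "length xs \<le> m"
          and hv: "real (card V) / (2 * (K ^ j * \<Lambda>)) \<le> real (card (heavy (grow xs)))"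
        have "hv j L xs \<in> \<D>0"
          using L(1) xs Suc.prems unfolding \<D>0_def W_def by force
        moreover have "real (card V) / (2 * K ^ r * \<Lambda>) \<le> real (card V) / (2 * (K ^ j * \<Lambda>))"
        proof (cases "\<Lambda> = 0")
          case False
          then show ?thesis
            using \<Lambda>0 K1 Suc.prems by (intro divide_left_mono) (auto intro!: mult_right_mono power_increasing)
        qed simp
        ultimately have "hv j L xs \<in> \<D>" using hv by (simp add: \<D>_def hv_def gr_def)
        then show "m < card (X \<inter> heavy (grow xs))"
          using X by (simp add: hv_def gr_def)
      qed (rule exI, intro conjI)
      then obtain xs where xs: "set xs \<subseteq> V" "set xs \<subseteq> X" "length xs \<le> m"
        "q * MM j \<le> real (card (grow xs))" "spread el {Suc j..<r} (cap + q * cc j) q (grow xs)"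
        by blast
      have "grow xs \<in> S (Suc j)" using L(1) xs unfolding SSuc W_def gr_def by force
      moreover have "cap + q * cc j = cc (Suc j)"
        unfolding cap_def by (simp add: cc_def K_def algebra_simps)
      moreover have "q * MM j = MM (Suc j)" by (simp add: MM_def)
      ultimately show ?case
        using xs L(2,5) grow_subset[of xs] el_grow[of _ xs]
        by (intro bexI[of _ "grow xs"]) (auto simp: less_Suc_eq)
    qed
    from this[of r] obtain L where L: "L \<subseteq> \<Omega>" "MM r \<le> real (card L)" "\<forall>f\<in>L. \<forall>i<r. el f i \<in> X"
      by auto
    have "0 < MM r" using N0 q by (simp add: MM_def)
    then have "L \<noteq> {}" using L(2) by auto
    then show ?thesis using L by blast
  qed
  show ?thesis
  proof (rule that[of \<D>])
    show "\<forall>X. (\<forall>D\<in>\<D>. m < card (X \<inter> D)) \<longrightarrow> (\<exists>f\<in>\<Omega>. \<forall>i<r. el f i \<in> X)"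
      using main by blast
  qed (use fin\<D>0 card\<D> \<D>V in \<open>auto simp: \<D>_def K_def\<close>)
qed

section \<open>Breaker's potential and overlapping copies\<close>

lemma breaker_forces_mono:
  assumes "breaker_forces b X Q" "\<And>M. Q M \<Longrightarrow> Q' M"
  shows "breaker_forces b X Q'"
  using assms unfolding breaker_forces_def by metis

text \<open>Breaker takes the most dangerous element \<open>k\<close> times. Dangers only decrease,
  so each removed element was at least as dangerous as any element that is left at the end, and the
  total has dropped by at least \<open>k\<close> times the danger of the latter.\<close>

lemma greedy_blocking_set:
  fixes w :: "'a set \<Rightarrow> real"
  assumes w0: "\<And>A. A \<in> \<A> \<Longrightarrow> 0 \<le> w A" and finU: "finite U"
  obtains B where "B \<subseteq> U" "card B \<le> k"
    "(\<Sum>A\<in>\<A>. w A * of_bool (A \<inter> B = {})) \<le> (\<Sum>A\<in>\<A>. w A)"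
    "\<And>x. x \<in> U - B \<Longrightarrow> (\<Sum>A\<in>\<A>. w A * of_bool (A \<inter> B = {}))
       + real k * (\<Sum>A\<in>\<A>. w A * of_bool (A \<inter> B = {} \<and> x \<in> A)) \<le> (\<Sum>A\<in>\<A>. w A)"
proof -
  define T where "T B = (\<Sum>A\<in>\<A>. w A * of_bool (A \<inter> B = {}))" for B
  define d where "d B x = (\<Sum>A\<in>\<A>. w A * of_bool (A \<inter> B = {} \<and> x \<in> A))" for B x
  have T_insert: "T (insert y B) = T B - d B y" for B y
  proof -
    have "T B - d B y = (\<Sum>A\<in>\<A>. w A * of_bool (A \<inter> B = {}) - w A * of_bool (A \<inter> B = {} \<and> y \<in> A))"
      unfolding T_def d_def by (rule sum_subtractf[symmetric])
    also have "\<dots> = T (insert y B)"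
      unfolding T_def by (rule sum.cong) auto
    finally show ?thesis by simp
  qed
  have d0: "0 \<le> d B x" for B x unfolding d_def using w0 by (intro sum_nonneg) auto
  have d_insert: "d (insert y B) x \<le> d B x" for y B x
    unfolding d_def using w0 by (intro sum_mono mult_left_mono) auto
  have "\<exists>B\<subseteq>U. card B \<le> k \<and> T B \<le> T {} \<and> (\<forall>x\<in>U - B. T B + real k * d B x \<le> T {})"
  proof (induction k)
    case 0
    show ?case by (rule exI[of _ "{}"]) simp
  next
    case (Suc k)
    then obtain B where B: "B \<subseteq> U" "card B \<le> k" "T B \<le> T {}"
      "\<And>x. x \<in> U - B \<Longrightarrow> T B + real k * d B x \<le> T {}" by blast
    show ?case
    proof (cases "U - B = {}")
      case True
      then show ?thesis using B by (intro exI[of _ B]) auto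
    next
      case False
      then have "Max (d B ` (U - B)) \<in> d B ` (U - B)" using finU by (intro Max_in) auto
      then obtain y where y: "y \<in> U - B" "d B y = Max (d B ` (U - B))" by auto
      have ymax: "d B x \<le> d B y" if "x \<in> U - B" for x
        unfolding y(2) using that finU by simp
      have "card (insert y B) \<le> Suc k"
        using B(2) card_insert_le_m1[of "Suc k" B y] by simp
      moreover have "T (insert y B) + real (Suc k) * d (insert y B) x \<le> T {}"
        if "x \<in> U - insert y B" for x
      proof -
        have "real k * d (insert y B) x \<le> real k * d B x"
          using d_insert by (intro mult_left_mono) auto
        moreover have "d (insert y B) x \<le> d B y"
          using d_insert[of y B x] ymax[of x] that by force
        moreover have "T B + real k * d B x \<le> T {}" using B(4) that by blast
        ultimately show ?thesis unfolding T_insert of_nat_Suc by (simp add: distrib_right)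
      qed
      moreover have "T (insert y B) \<le> T {}"
        using B(3) d0[of B y] unfolding T_insert by linarith
      ultimately show ?thesis
        using B(1) y by (intro exI[of _ "insert y B"]) auto
    qed
  qed
  then obtain B where B: "B \<subseteq> U" "card B \<le> k" "T B \<le> T {}"
    "\<And>x. x \<in> U - B \<Longrightarrow> T B + real k * d B x \<le> T {}" by blast
  have T: "T {} = (\<Sum>A\<in>\<A>. w A)" by (simp add: T_def)
  show ?thesis
    by (rule that[OF B(1,2)]) (use B(3,4) in \<open>unfold T, unfold T_def d_def\<close>)
qed

text \<open>The factor \<open>b + 1\<close> pays for Maker's first move; each later move of Maker is compensated by
  Breaker's preceding reply.\<close>

lemma breaker_potential_stage:
  fixes W :: "'a set \<Rightarrow> real"
  assumes finX: "finite X" and fin\<A>: "finite \<A>" and W0: "\<And>A. 0 \<le> W A"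
  shows "breaker_forces b X (\<lambda>M. (\<Sum>A | A \<in> \<A> \<and> A \<subseteq> M. W A)
    \<le> (real b + 1) * (\<Sum>A | A \<in> \<A> \<and> A \<subseteq> X. W A * (1 / (real b + 1)) ^ card A))"
proof -
  define q where "q = 1 / (real b + 1)"
  have q: "0 < q" "(real b + 1) * q = 1" by (simp_all add: q_def)
  define \<B> where "\<B> = {A. A \<in> \<A> \<and> A \<subseteq> X}"
  have fin\<B>: "finite \<B>" using fin\<A> by (simp add: \<B>_def)
  define lost where "lost rs = claimed rs - maker_set rs" for rs :: "'a stage"
  define pot where "pot rs = (\<Sum>A\<in>\<B>. W A * q ^ card (A - maker_set rs) * of_bool (A \<inter> lost rs = {}))"
    for rs :: "'a stage"
  define dan where "dan rs x =
    (\<Sum>A\<in>\<B>. W A * q ^ card (A - maker_set rs) * of_bool (A \<inter> lost rs = {} \<and> x \<in> A))"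
    for rs :: "'a stage" and x
  define C where "C = (real b + 1) * (\<Sum>A\<in>\<B>. W A * q ^ card A)"
  \<comment> \<open>The second clause looks one move ahead: Maker's claim of \<open>x\<close>
    multiplies the weight of the live sets through \<open>x\<close> by b + 1, which raises
    \<open>pot\<close> by \<open>b * dan rs x\<close>.\<close>
  define Inv where "Inv rs \<longleftrightarrow> pot rs \<le> C \<and> (\<forall>x\<in>X - claimed rs. pot rs + b * dan rs x \<le> C)"
    for rs :: "'a stage"
  have pot_Nil: "pot [] = (\<Sum>A\<in>\<B>. W A * q ^ card A)" by (simp add: pot_def lost_def)
  have pot0: "0 \<le> pot []" unfolding pot_Nil using W0 q by (intro sum_nonneg) auto
  have "dan [] x \<le> pot []" for x
    unfolding dan_def pot_def using W0 q by (intro sum_mono mult_left_mono) (auto simp: lost_def)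
  then have "pot [] + b * dan [] x \<le> pot [] + b * pot []" for x
    by (intro add_left_mono mult_left_mono) auto
  then have "Inv []"
    unfolding Inv_def C_def pot_Nil[symmetric] using pot0 by (simp add: algebra_simps)
  moreover have "\<exists>B\<subseteq>X - claimed rs - {x}. card B \<le> b \<and> Inv (rs @ [(x, B)])"
    if leg: "legal_rounds b X rs" and inv: "Inv rs" and x: "x \<in> X - claimed rs" for rs x
  proof -
    define w where "w A = W A * q ^ card (A - insert x (maker_set rs)) * of_bool (A \<inter> lost rs = {})"
      for A
    have xM: "x \<notin> maker_set rs" "x \<notin> lost rs"
      using x maker_set_subset_claimed[of rs] by (auto simp: lost_def)
    have w_eq: "w A = W A * q ^ card (A - maker_set rs) * of_bool (A \<inter> lost rs = {})
        + real b * (W A * q ^ card (A - maker_set rs) * of_bool (A \<inter> lost rs = {} \<and> x \<in> A))"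
      if "A \<in> \<B>" for A
    proof (cases "x \<in> A")
      case True
      have "finite (A - maker_set rs)" using that finX finite_subset by (auto simp: \<B>_def)
      then have "card (A - maker_set rs) = Suc (card (A - maker_set rs - {x}))"
        using True xM by (intro card_Suc_Diff1[symmetric]) auto
      moreover have "A - maker_set rs - {x} = A - insert x (maker_set rs)" by auto
      ultimately have "q ^ card (A - insert x (maker_set rs))
          = (real b + 1) * q ^ card (A - maker_set rs)"
        using q(2) by (simp add: mult.assoc[symmetric])
      then show ?thesis using True by (simp add: w_def algebra_simps)
    next
      case False
      then have "A - insert x (maker_set rs) = A - maker_set rs" by auto
      then show ?thesis using False by (simp add: w_def)
    qed
    \<comment> \<open>\<open>w\<close> is the weight after Maker's claim and before Breaker's
      reply.\<close>
    have "(\<Sum>A\<in>\<B>. w A) = pot rs + b * dan rs x"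
      unfolding pot_def dan_def sum_distrib_left sum.distrib[symmetric]
      using w_eq by (rule sum.cong[OF refl])
    also have "\<dots> \<le> C" using inv x by (auto simp: Inv_def)
    finally have sw: "(\<Sum>A\<in>\<B>. w A) \<le> C" .
    have w0: "0 \<le> w A" for A using W0 q by (simp add: w_def)
    have finU: "finite (X - claimed rs - {x})" using finX by simp
    obtain B where B: "B \<subseteq> X - claimed rs - {x}" "card B \<le> b"
      "(\<Sum>A\<in>\<B>. w A * of_bool (A \<inter> B = {})) \<le> (\<Sum>A\<in>\<B>. w A)"
      "\<And>y. y \<in> X - claimed rs - {x} - B \<Longrightarrow> (\<Sum>A\<in>\<B>. w A * of_bool (A \<inter> B = {}))
       + real b * (\<Sum>A\<in>\<B>. w A * of_bool (A \<inter> B = {} \<and> y \<in> A)) \<le> (\<Sum>A\<in>\<B>. w A)"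
      by (rule greedy_blocking_set[of \<B> w "X - claimed rs - {x}" b, OF w0 finU], rule that)
    have lost': "lost (rs @ [(x, B)]) = lost rs \<union> B"
      using B(1) xM x maker_set_subset_claimed[of rs] by (auto simp: lost_def)
    have pot': "pot (rs @ [(x, B)]) = (\<Sum>A\<in>\<B>. w A * of_bool (A \<inter> B = {}))"
      unfolding pot_def w_def lost' by (rule sum.cong) (auto simp: Int_Un_distrib)
    have dan': "dan (rs @ [(x, B)]) y = (\<Sum>A\<in>\<B>. w A * of_bool (A \<inter> B = {} \<and> y \<in> A))" for y
      unfolding dan_def w_def lost' by (rule sum.cong) (auto simp: Int_Un_distrib)
    have "Inv (rs @ [(x, B)])"
      unfolding Inv_def
    proof (intro conjI ballI)
      show "pot (rs @ [(x, B)]) \<le> C" using B(3) sw unfolding pot' by linarith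
      fix y assume "y \<in> X - claimed (rs @ [(x, B)])"
      then have "y \<in> X - claimed rs - {x} - B" by auto
      from B(4)[OF this] show "pot (rs @ [(x, B)]) + b * dan (rs @ [(x, B)]) y \<le> C"
        using sw unfolding pot' dan' by linarith
    qed
    then show ?thesis using B(1,2) by blast
  qed
  ultimately have "stage_invariant b X Inv" by (simp add: stage_invariant_def)
  moreover have "(\<Sum>A | A \<in> \<A> \<and> A \<subseteq> maker_set rs. W A) \<le> C"
    if leg: "legal_rounds b X rs" and cl: "claimed rs = X" and inv: "Inv rs" for rs
  proof -
    have "(\<Sum>A | A \<in> \<A> \<and> A \<subseteq> maker_set rs. W A)
        = (\<Sum>A | A \<in> \<A> \<and> A \<subseteq> maker_set rs.
            W A * q ^ card (A - maker_set rs) * of_bool (A \<inter> lost rs = {}))"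
    proof (rule sum.cong[OF refl])
      fix A assume "A \<in> {A. A \<in> \<A> \<and> A \<subseteq> maker_set rs}"
      then have "card (A - maker_set rs) = 0" "A \<inter> lost rs = {}"
        by (auto simp: lost_def Diff_eq_empty_iff[THEN iffD2])
      then show "W A = W A * q ^ card (A - maker_set rs) * of_bool (A \<inter> lost rs = {})"
        by simp
    qed
    also have "\<dots> \<le> pot rs"
      unfolding pot_def using fin\<B> W0 q cl maker_set_subset_claimed[of rs]
      by (intro sum_mono2) (auto simp: \<B>_def)
    finally show ?thesis using inv by (simp add: Inv_def)
  qed
  ultimately show ?thesis
    unfolding breaker_forces_def C_def \<B>_def q_def by blast
qed

text \<open>Breaker answers in the class that Maker has just entered, unless he already owns an
  element there. A class that Maker never enters drops out completely, any other class with at least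
  two elements loses one to Breaker.\<close>

lemma breaker_shrinks_classes:
  assumes finX: "finite X" and b: "b \<ge> 1"
    and cl: "\<And>x. x \<in> cl x" "\<And>x y. y \<in> cl x \<Longrightarrow> cl y = cl x"
  shows "breaker_forces b X
    (\<lambda>M. M \<subseteq> X \<and> (\<forall>a. 2 \<le> card (cl a \<inter> X) \<longrightarrow> card (cl a \<inter> M) < card (cl a \<inter> X)))"
proof -
  define Inv where "Inv rs \<longleftrightarrow> (\<forall>a. cl a \<inter> maker_set rs \<noteq> {} \<and> 2 \<le> card (cl a \<inter> X) \<longrightarrow>
    cl a \<inter> X \<inter> (claimed rs - maker_set rs) \<noteq> {})" for rs
  have "\<exists>B\<subseteq>X - claimed rs - {x}. card B \<le> b \<and> Inv (rs @ [(x, B)])"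
    if leg: "legal_rounds b X rs" and inv: "Inv rs" and x: "x \<in> X - claimed rs" for rs x
  proof -
    have sub: "maker_set rs \<subseteq> claimed rs" by (rule maker_set_subset_claimed)
    define B where "B = (if cl x \<inter> X \<inter> (claimed rs - maker_set rs) = {} \<and> cl x \<inter> (X - claimed rs - {x}) \<noteq> {}
      then {SOME y. y \<in> cl x \<inter> (X - claimed rs - {x})} else {})"
    have B: "B \<subseteq> cl x \<inter> (X - claimed rs - {x})" "card B \<le> b"
      using b some_in_eq[of "cl x \<inter> (X - claimed rs - {x})"] by (auto simp: B_def)
    have "Inv (rs @ [(x, B)])"
      unfolding Inv_def
    proof (intro allI impI, elim conjE)
      fix a
      assume m: "cl a \<inter> maker_set (rs @ [(x, B)]) \<noteq> {}" and two: "2 \<le> card (cl a \<inter> X)"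
      have old: "cl a \<inter> X \<inter> (claimed rs - maker_set rs)
          \<subseteq> cl a \<inter> X \<inter> (claimed (rs @ [(x, B)]) - maker_set (rs @ [(x, B)]))"
        using x by auto
      show "cl a \<inter> X \<inter> (claimed (rs @ [(x, B)]) - maker_set (rs @ [(x, B)])) \<noteq> {}"
      proof (cases "cl a \<inter> X \<inter> (claimed rs - maker_set rs) = {}")
        case False
        then show ?thesis using old by blast
      next
        case True
        then have no: "cl a \<inter> maker_set rs = {}" using inv two by (auto simp: Inv_def)
        then have "x \<in> cl a" using m by auto
        then have ax: "cl a = cl x" using cl(2) by blast
        \<comment> \<open>Neither player has been in this class before, so all its elements other
          than \<open>x\<close> are still free.\<close>
        have "\<not> cl a \<inter> X \<subseteq> {x}"
          using two card_mono[of "{x}" "cl a \<inter> X"] by auto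
        then have "cl x \<inter> (X - claimed rs - {x}) \<noteq> {}"
          using True no ax by auto
        then have "B \<noteq> {}" using True ax by (auto simp: B_def)
        then obtain y where "y \<in> B" by blast
        then have "y \<in> cl a \<inter> X \<inter> (claimed (rs @ [(x, B)]) - maker_set (rs @ [(x, B)]))"
          using B(1) ax sub by auto
        then show ?thesis by blast
      qed
    qed
    then show ?thesis using B by blast
  qed
  then have "stage_invariant b X Inv" by (simp add: stage_invariant_def Inv_def)
  moreover have "maker_set rs \<subseteq> X \<and>
      (\<forall>a. 2 \<le> card (cl a \<inter> X) \<longrightarrow> card (cl a \<inter> maker_set rs) < card (cl a \<inter> X))"
    if leg: "legal_rounds b X rs" and claimed: "claimed rs = X" and inv: "Inv rs" for rs
  proof (intro conjI allI impI)
    show sub: "maker_set rs \<subseteq> X" using maker_set_subset_claimed[of rs] claimed by simp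
    fix a assume two: "2 \<le> card (cl a \<inter> X)"
    have "cl a \<inter> maker_set rs \<subset> cl a \<inter> X"
    proof (cases "cl a \<inter> maker_set rs = {}")
      case True
      have "cl a \<inter> X \<noteq> {}" using two by force
      then show ?thesis using True by auto
    next
      case False
      then have "cl a \<inter> X \<inter> (claimed rs - maker_set rs) \<noteq> {}"
        using inv two by (simp add: Inv_def)
      then show ?thesis using sub by auto
    qed
    then show "card (cl a \<inter> maker_set rs) < card (cl a \<inter> X)"
      using finX by (intro psubset_card_mono) auto
  qed
  ultimately show ?thesis unfolding breaker_forces_def by blast
qed

section \<open>Chains of overlapping sets and Breaker's win in two phases\<close>

text \<open>Members of \<open>chain_unions \<G> k\<close> are unions of \<open>k + 1\<close> sets.\<close>

fun chain_unions :: "'a set set \<Rightarrow> nat \<Rightarrow> 'a set set" where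
  "chain_unions \<G> 0 = \<G>"
| "chain_unions \<G> (Suc k) = {U \<union> F | U F. U \<in> chain_unions \<G> k \<and> F \<in> \<G> \<and> U \<inter> F \<noteq> {} \<and> \<not> F \<subseteq> U}"

lemma chains_bounds:
  assumes "finite \<G>" "\<And>F. F \<in> \<G> \<Longrightarrow> finite F \<and> card F \<le> e" "U \<in> chain_unions \<G> k"
  shows "finite U \<and> card U \<le> Suc k * e"
  using assms(3)
proof (induction k arbitrary: U)
  case (Suc k)
  then obtain U' F where U: "U = U' \<union> F" "U' \<in> chain_unions \<G> k" "F \<in> \<G>" by auto
  then have "finite U'" "card U' \<le> Suc k * e" using Suc.IH by auto
  then show ?case
    using assms(2)[OF U(3)] card_Un_le[of U' F] U(1) by simp
qed (use assms(2) in auto)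

lemma finite_chains: "finite \<G> \<Longrightarrow> finite (chain_unions \<G> k)"
proof (induction k)
  case (Suc k)
  have "chain_unions \<G> (Suc k) \<subseteq> (\<lambda>(U, F). U \<union> F) ` (chain_unions \<G> k \<times> \<G>)" by auto
  then show ?case using Suc by (meson finite_SigmaI finite_imageI finite_subset)
qed simp

text \<open>Starting from \<open>F\<close>, adjoin sets of \<G> inside \<open>X\<close> that meet
  the union without lying in it. If this went on for \<open>k\<close> steps, a chain of
  \<open>k + 1\<close> sets would lie in \<open>X\<close>. Hence it stops with at most
  \<open>k\<close> sets, that is with at most \<open>k * e\<close> elements.\<close>

lemma closed_chain:
  assumes fin: "finite \<G>" "\<And>F. F \<in> \<G> \<Longrightarrow> finite F \<and> card F \<le> e"
    and none: "\<And>U. U \<in> chain_unions \<G> k \<Longrightarrow> \<not> U \<subseteq> X"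
    and F: "F \<in> \<G>" "F \<subseteq> X"
  shows "\<exists>U. F \<subseteq> U \<and> U \<subseteq> X \<and> finite U \<and> card U \<le> k * e \<and>
    (\<forall>F'\<in>\<G>. F' \<subseteq> X \<and> U \<inter> F' \<noteq> {} \<longrightarrow> F' \<subseteq> U)" (is "\<exists>U. ?closed U")
proof (rule ccontr)
  assume no: "\<not> (\<exists>U. ?closed U)"
  have "\<exists>U\<in>chain_unions \<G> j. F \<subseteq> U \<and> U \<subseteq> X" if "j \<le> k" for j
    using that
  proof (induction j)
    case 0
    then show ?case using F by auto
  next
    case (Suc j)
    then obtain U where U: "U \<in> chain_unions \<G> j" "F \<subseteq> U" "U \<subseteq> X" by auto
    have "finite U \<and> card U \<le> Suc j * e" using chains_bounds[OF fin U(1)] .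
    moreover have "Suc j * e \<le> k * e" using Suc.prems by (intro mult_right_mono) auto
    ultimately have "finite U" "card U \<le> k * e" by auto
    then obtain F' where F': "F' \<in> \<G>" "F' \<subseteq> X" "U \<inter> F' \<noteq> {}" "\<not> F' \<subseteq> U"
      proof -
      have "\<not> ?closed U" using no by (rule contrapos_nn) (rule exI)
      then have "\<not> (\<forall>F'\<in>\<G>. F' \<subseteq> X \<and> U \<inter> F' \<noteq> {} \<longrightarrow> F' \<subseteq> U)"
        using U(2,3) \<open>finite U\<close> \<open>card U \<le> k * e\<close> by simp
      then show ?thesis using that by blast
    qed
    have "U \<union> F' \<in> chain_unions \<G> (Suc j)"
      unfolding chain_unions.simps using U(1) F'(1,3,4) by (intro CollectI exI[of _ U] exI[of _ F']) simp
    moreover have "U \<union> F' \<subseteq> X" using U(3) F'(2) by simp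
    ultimately show ?case using U(2) by (intro bexI[of _ "U \<union> F'"]) auto
  qed
  from this[of k] none show False by auto
qed

text \<open>During \<open>s\<close> stages the potential, below 1 by \<open>few\<close>, removes all
  chains of \<open>k + 1\<close> sets. The rest of the board falls into classes of at most
  \<open>Suc (k * e)\<close> elements, and each class of size at least two shrinks in every further
  stage. In the end no class can hold two elements, as a set of \<G> inside a winning set would
  need.\<close>

theorem breaker_wins:
  fixes H :: "'a hypergraph" and \<G> :: "'a set set"
  assumes finH: "finite (fst H)" and b: "b \<ge> 1"
    and fin: "finite \<G>" "\<And>F. F \<in> \<G> \<Longrightarrow> finite F \<and> card F \<le> e"
    and two: "\<And>F. F \<in> \<G> \<Longrightarrow> 2 \<le> card F"
    and win: "\<And>F. F \<in> snd H \<Longrightarrow> F \<subseteq> fst H \<and> (\<exists>G\<in>\<G>. G \<subseteq> F)"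
    and few: "(real b + 1) ^ s * (\<Sum>U\<in>chain_unions \<G> k. ((1 / (real b + 1)) ^ s) ^ card U) < 1"
  shows "\<not> maker_ensures b H (s + Suc (k * e))"
proof
  assume "maker_ensures b H (s + Suc (k * e))"
  then obtain \<sigma> where \<sigma>: "maker_strategy b H \<sigma>"
    and ens: "\<And>p. play b H p \<Longrightarrow> follows \<sigma> p \<Longrightarrow> length p \<le> s + Suc (k * e) \<Longrightarrow>
      snd (after_stages H p) \<noteq> {}"
    unfolding maker_ensures_def by blast
  define \<C> where "\<C> = chain_unions \<G> k"
  have fin\<C>: "finite \<C>" using finite_chains[OF fin(1)] by (simp add: \<C>_def)
  define p1 where "p1 = 1 / (real b + 1)"
  have p1: "0 < p1" by (simp add: p1_def)
  \<comment> \<open>Weighs every chain by its survival over the \<open>s - i\<close> stages still to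
    come; the prefactor collects the loss of b + 1 in each of them.\<close>
  define J where "J i X \<longleftrightarrow>
    (real b + 1) ^ (s - i) * (\<Sum>U | U \<in> \<C> \<and> U \<subseteq> X. (p1 ^ (s - i)) ^ card U) < 1" for i X
  have J0: "J 0 (fst H)"
  proof -
    have "(\<Sum>U | U \<in> \<C> \<and> U \<subseteq> fst H. (p1 ^ s) ^ card U) \<le> (\<Sum>U\<in>\<C>. (p1 ^ s) ^ card U)"
      using fin\<C> p1 by (intro sum_mono2) auto
    then have "(real b + 1) ^ s * (\<Sum>U | U \<in> \<C> \<and> U \<subseteq> fst H. (p1 ^ s) ^ card U)
        \<le> (real b + 1) ^ s * (\<Sum>U\<in>\<C>. (p1 ^ s) ^ card U)"
      by (intro mult_left_mono) auto
    also have "\<dots> < 1" using few unfolding \<C>_def p1_def .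
    finally show ?thesis by (simp add: J_def)
  qed
  have Jstep: "breaker_forces b X (J (Suc i))" if i: "i < s" and X: "X \<subseteq> fst H" and J: "J i X" for i X
  proof -
    have finX: "finite X" using X finH finite_subset by blast
    define t where "t = s - Suc i"
    have si: "s - i = Suc t" using i by (simp add: t_def)
    show ?thesis
    proof (rule breaker_forces_mono[OF breaker_potential_stage[OF finX fin\<C>,
            of "\<lambda>U. (p1 ^ t) ^ card U" b]])
      show "0 \<le> (p1 ^ t) ^ card A" for A :: "'a set" using p1 by simp
      fix M
      assume "(\<Sum>A | A \<in> \<C> \<and> A \<subseteq> M. (p1 ^ t) ^ card A) \<le> (real b + 1) *
        (\<Sum>A | A \<in> \<C> \<and> A \<subseteq> X. (p1 ^ t) ^ card A * (1 / (real b + 1)) ^ card A)"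
      then have "(real b + 1) ^ t * (\<Sum>A | A \<in> \<C> \<and> A \<subseteq> M. (p1 ^ t) ^ card A) \<le> (real b + 1) ^ t *
        ((real b + 1) * (\<Sum>A | A \<in> \<C> \<and> A \<subseteq> X. (p1 ^ t) ^ card A * (1 / (real b + 1)) ^ card A))"
        by (intro mult_left_mono) auto
      also have "\<dots> = (real b + 1) ^ Suc t * (\<Sum>A | A \<in> \<C> \<and> A \<subseteq> X. (p1 ^ Suc t) ^ card A)"
        by (simp add: p1_def[symmetric] power_mult_distrib mult_ac)
      also have "\<dots> < 1" using J unfolding J_def si .
      finally show "J (Suc i) M" by (simp add: J_def t_def)
    qed
  qed
  obtain p where p: "play b H p" "follows \<sigma> p" "length p \<le> length ([] :: 'a stage list) + s"
    "snd (after_stages H p) = {} \<or> J s (fst (after_stages H p))"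
  proof (rule breaker_forces_play[OF finH \<sigma> play.start follows_Nil, of J s])
    show "J 0 (fst (after_stages H []))" using J0 by simp
  qed (use Jstep in auto)
  define X where "X = fst (after_stages H p)"
  have X: "X \<subseteq> fst H" using board_subset[OF p(1)] X_def by simp
  have finX: "finite X" using X finH finite_subset by blast
  have "snd (after_stages H p) \<noteq> {}" using ens p by simp
  then have "J s X" using p(4) X_def by blast
  \<comment> \<open>For \<open>i = s\<close> all weights are 1, so the sum is the number of chains
    inside \<open>X\<close>, a natural number below 1.\<close>
  then have "card {U. U \<in> \<C> \<and> U \<subseteq> X} = 0" by (simp add: J_def)
  then have none: "\<not> U \<subseteq> X" if "U \<in> chain_unions \<G> k" for U
    using that fin\<C> by (auto simp: \<C>_def)
  \<comment> \<open>The classes of the equivalence relation generated by lying in a common set of \<open>\<G>\<close> inside \<open>X\<close>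
    are contained in closed chains, hence small.\<close>
  define R where "R = {(x, y). \<exists>F\<in>\<G>. F \<subseteq> X \<and> x \<in> F \<and> y \<in> F}"
  define cl where "cl x = {y. (x, y) \<in> R\<^sup>*}" for x
  have symR: "sym (R\<^sup>*)" by (rule sym_rtrancl) (auto simp: sym_def R_def)
  have cl: "x \<in> cl x" "y \<in> cl x \<Longrightarrow> cl y = cl x" for x y
    using symD[OF symR] by (auto simp: cl_def intro: rtrancl_trans)
  \<comment> \<open>An element in no set of \<G> inside \<open>X\<close> forms a class of its own;
    \<open>Suc\<close> makes the bound valid for it even if \<open>k * e = 0\<close>.\<close>
  have card_cl: "card (cl a \<inter> X) \<le> Suc (k * e)" for a
  proof (cases "\<exists>F\<in>\<G>. F \<subseteq> X \<and> a \<in> F")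
    case True
    then obtain F where F: "F \<in> \<G>" "F \<subseteq> X" "a \<in> F" by blast
    obtain U where U: "F \<subseteq> U" "U \<subseteq> X" "finite U" "card U \<le> k * e"
      "\<And>F'. F' \<in> \<G> \<Longrightarrow> F' \<subseteq> X \<Longrightarrow> U \<inter> F' \<noteq> {} \<Longrightarrow> F' \<subseteq> U"
      using closed_chain[of \<G> e k X F] fin none F(1,2) by auto
    have "y \<in> U" if "(a, y) \<in> R\<^sup>*" for y
      using that
    proof (induction rule: rtrancl_induct)
      case base
      then show ?case using F U by auto
    next
      case (step y z)
      then show ?case using U(5) by (auto simp: R_def)
    qed
    then have "cl a \<inter> X \<subseteq> U" by (auto simp: cl_def)
    then have "card (cl a \<inter> X) \<le> card U" using U(3) by (intro card_mono) auto
    then show ?thesis using U(4) by simp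
  next
    case False
    have "y = a" if "(a, y) \<in> R\<^sup>*" for y
      using that False by (induction rule: rtrancl_induct) (auto simp: R_def)
    then have "cl a \<inter> X \<subseteq> {a}" by (auto simp: cl_def)
    then show ?thesis using card_mono[of "{a}" "cl a \<inter> X"] by simp
  qed
  \<comment> \<open>Singletons no longer shrink, hence the \<open>max\<close>; the bound is 1 from
    \<open>i = k * e\<close> on.\<close>
  define J' where "J' i Y \<longleftrightarrow> Y \<subseteq> X \<and> (\<forall>a. card (cl a \<inter> Y) \<le> max 1 (Suc (k * e) - i))" for i Y
  have J'step: "breaker_forces b Y (J' (Suc i))" if "Y \<subseteq> fst H" and J': "J' i Y" for i Y
  proof -
    have finY: "finite Y" using J' finX finite_subset by (auto simp: J'_def)
    show ?thesis
    proof (rule breaker_forces_mono[OF breaker_shrinks_classes[OF finY b cl]], assumption)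
      fix M
      assume M: "M \<subseteq> Y \<and> (\<forall>a. 2 \<le> card (cl a \<inter> Y) \<longrightarrow> card (cl a \<inter> M) < card (cl a \<inter> Y))"
      have "card (cl a \<inter> M) \<le> max 1 (Suc (k * e) - Suc i)" for a
      proof (cases "2 \<le> card (cl a \<inter> Y)")
        case True
        moreover have "card (cl a \<inter> Y) \<le> max 1 (Suc (k * e) - i)" using J' by (simp add: J'_def)
        ultimately show ?thesis using M by fastforce
      next
        case False
        moreover have "card (cl a \<inter> M) \<le> card (cl a \<inter> Y)"
          using M finY by (intro card_mono) auto
        ultimately show ?thesis by linarith
      qed
      then show "J' (Suc i) M" using M J' by (auto simp: J'_def)
    qed
  qed
  obtain p' where p': "play b H p'" "follows \<sigma> p'" "length p' \<le> length p + Suc (k * e)"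
    "snd (after_stages H p') = {} \<or> J' (Suc (k * e)) (fst (after_stages H p'))"
  proof (rule breaker_forces_play[OF finH \<sigma> p(1,2), of J' "Suc (k * e)"])
    show "J' 0 (fst (after_stages H p))"
      using card_cl by (auto simp: J'_def X_def[symmetric] intro: order_trans)
  qed (use J'step in auto)
  have ne: "snd (after_stages H p') \<noteq> {}" using ens p' p(3) by auto
  then have J': "J' (Suc (k * e)) (fst (after_stages H p'))" using p'(4) by blast
  obtain F where "F \<in> snd H" "F \<subseteq> fst (after_stages H p')"
    using ne winning_sets_after_stages[OF p'(1)] win by auto
  then obtain G where G: "G \<in> \<G>" "G \<subseteq> fst (after_stages H p')" using win by blast
  have "G \<noteq> {}" using two[OF G(1)] by force
  then obtain a where a: "a \<in> G" by blast
  have "G \<subseteq> X" using G(2) J' by (auto simp: J'_def)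
  then have "(a, y) \<in> R" if "y \<in> G" for y using that a G(1) by (auto simp: R_def)
  then have "G \<subseteq> cl a \<inter> fst (after_stages H p')" using G(2) by (auto simp: cl_def)
  moreover have "finite (fst (after_stages H p'))"
    using board_subset[OF p'(1)] finH finite_subset by blast
  ultimately have "card G \<le> card (cl a \<inter> fst (after_stages H p'))"
    by (intro card_mono) auto
  also have "\<dots> \<le> 1" using J' by (simp add: J'_def)
  finally show False using two[OF G(1)] by simp
qed

section \<open>Copies of a graph in the complete graph\<close>

lemma edges_card_Union:
  assumes "simple_graph H" "A \<subseteq> snd H"
  shows "finite A" "\<Union>A \<subseteq> fst H" "finite (\<Union>A)" "\<And>e. e \<in> A \<Longrightarrow> card e = 2 \<and> finite e"
    "card (\<Union>A) \<le> 2 * card A"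
proof -
  have e: "e \<subseteq> fst H \<and> card e = 2 \<and> finite e" if "e \<in> A" for e
  proof -
    have "e \<subseteq> fst H \<and> card e = 2" using assms that by (auto simp: simple_graph_def)
    then show ?thesis using card.infinite[of e] by auto
  qed
  then show "\<Union>A \<subseteq> fst H" "\<And>e. e \<in> A \<Longrightarrow> card e = 2 \<and> finite e" by auto
  then show "finite (\<Union>A)" using assms(1) finite_subset unfolding simple_graph_def by blast
  then show "finite A" by (rule finite_UnionD)
  then have "card (\<Union>A) \<le> sum card A"
    using card_Union_le_sum_card by blast
  also have "\<dots> = 2 * card A" using e by simp
  finally show "card (\<Union>A) \<le> 2 * card A" .
qed

lemma edges_card_Union_ge_3:
  assumes "simple_graph H" "A \<subseteq> snd H" "2 \<le> card A"
  shows "3 \<le> card (\<Union>A)"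
proof -
  note A = edges_card_Union[OF assms(1,2)]
  obtain e e' where e: "e \<in> A" "e' \<in> A" "e \<noteq> e'"
    using assms(3) card_le_Suc0_iff_eq[OF A(1)] by force
  have "\<not> e' \<subseteq> e"
    using e(3) A(4)[OF e(1)] A(4)[OF e(2)] card_subset_eq[of e e'] by auto
  then have "e \<subset> e \<union> e'" by blast
  then have "card e < card (e \<union> e')" using A(4) e by (intro psubset_card_mono) auto
  also have "\<dots> \<le> card (\<Union>A)" using A(3) e by (intro card_mono) auto
  finally show ?thesis using A(4) e by simp
qed

lemma finite_m2_set:
  assumes "simple_graph H"
  shows "finite {(real (e_num G) - 1) / (real (v_num G) - 2) | G. subgraph G H \<and> v_num G \<ge> 3}"
proof -
  have "finite (Pow (fst H) \<times> Pow (snd H))"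
    using assms edges_card_Union(1)[OF assms subset_refl] by (simp add: simple_graph_def)
  then show ?thesis
    by (rule finite_surj[where f = "\<lambda>G. (real (e_num G) - 1) / (real (v_num G) - 2)"])
      (force simp: subgraph_def)
qed

text \<open>Division-free form for edge sets: the board consists of edges, so a subgraph enters the
  counts only through its edges and the vertices they cover.\<close>

lemma m2_upper:
  assumes "simple_graph H" "A \<subseteq> snd H" "2 \<le> card A"
  shows "real (card A) - 1 \<le> m2 H * (real (card (\<Union>A)) - 2)"
proof -
  note 3 = edges_card_Union_ge_3[OF assms]
  have "subgraph (\<Union>A, A) H"
    using assms edges_card_Union[OF assms(1,2)] by (auto simp: subgraph_def simple_graph_def)
  then have "(real (card A) - 1) / (real (card (\<Union>A)) - 2) \<le> m2 H"
    unfolding m2_def using 3 finite_m2_set[OF assms(1)]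
    by (intro Max_ge CollectI exI[of _ "(\<Union>A, A)"]) (auto simp: e_num_def v_num_def)
  then show ?thesis using 3 by (simp add: field_simps)
qed

text \<open>Two edges cover at most four vertices, and (2 - 1) / (4 - 2) = 1 / 2. Besides positivity
  this gives 1 / m2 \<le> 2, so that the critical number n^(2 - 1/m2) of edges is at least
  1.\<close>

lemma m2_ge_half:
  assumes "simple_graph H" "2 \<le> e_num H"
  shows "1 / 2 \<le> m2 H"
proof -
  obtain A where A: "A \<subseteq> snd H" "card A = 2"
    using assms(2) obtain_subset_with_card_n[of 2 "snd H"] by (auto simp: e_num_def)
  define w where "w = real (card (\<Union>A))"
  have w: "3 \<le> w" "w \<le> 4"
    using edges_card_Union_ge_3[OF assms(1) A(1)] edges_card_Union(5)[OF assms(1) A(1)] A(2)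
    by (auto simp: w_def)
  have 1: "1 \<le> m2 H * (w - 2)" using m2_upper[OF assms(1) A(1)] A(2) by (simp add: w_def)
  then have "0 < m2 H * (w - 2)" by linarith
  then have "0 < m2 H" using w by (simp add: zero_less_mult_iff)
  then have "m2 H * (w - 2) \<le> m2 H * 2" using w by (intro mult_left_mono) auto
  then show ?thesis using 1 by linarith
qed

text \<open>A maximising subgraph may have isolated vertices; passing to its edges can only enlarge
  the quotient, so by \<open>m2_upper\<close> equality persists.\<close>

lemma m2_attained:
  assumes "simple_graph H" "2 \<le> e_num H"
  obtains S where "S \<subseteq> snd H" "2 \<le> card S" "real (card S) - 1 = m2 H * (real (card (\<Union>S)) - 2)"
proof -
  let ?M = "{(real (e_num G) - 1) / (real (v_num G) - 2) | G. subgraph G H \<and> v_num G \<ge> 3}"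
  have "3 \<le> card (\<Union>(snd H))"
    using edges_card_Union_ge_3[OF assms(1) subset_refl] assms(2) by (simp add: e_num_def)
  also have "\<dots> \<le> card (fst H)"
    using edges_card_Union(2)[OF assms(1) subset_refl] assms(1)
    by (intro card_mono) (auto simp: simple_graph_def)
  finally have "(real (e_num H) - 1) / (real (v_num H) - 2) \<in> ?M"
    using assms(1) by (intro CollectI exI[of _ H]) (auto simp: subgraph_def v_num_def)
  then have "?M \<noteq> {}" by blast
  then have "m2 H \<in> ?M" unfolding m2_def using finite_m2_set[OF assms(1)] by (rule Max_in[rotated])
  then obtain G where G: "subgraph G H" "3 \<le> v_num G"
    and m2: "m2 H = (real (e_num G) - 1) / (real (v_num G) - 2)" by blast
  define S where "S = snd G"
  have S: "S \<subseteq> snd H" using G(1) by (simp add: subgraph_def S_def)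
  have "0 < (real (e_num G) - 1) / (real (v_num G) - 2)"
    using m2_ge_half[OF assms] unfolding m2 by linarith
  then have two: "2 \<le> card S" using G(2) by (simp add: zero_less_divide_iff S_def e_num_def)
  note 3 = edges_card_Union_ge_3[OF assms(1) S two]
  have "card (\<Union>S) \<le> v_num G"
    using G(1) unfolding v_num_def S_def
    by (intro card_mono) (auto simp: subgraph_def simple_graph_def)
  then have "m2 H * (real (card (\<Union>S)) - 2) \<le> m2 H * (real (v_num G) - 2)"
    using m2_ge_half[OF assms] by (intro mult_left_mono) auto
  also have "\<dots> = real (card S) - 1" using G(2) by (simp add: m2 S_def e_num_def)
  finally have "real (card S) - 1 = m2 H * (real (card (\<Union>S)) - 2)"
    using m2_upper[OF assms(1) S two] by linarith
  then show ?thesis using that S two by blast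
qed

section \<open>Copies as winning sets, and counting maps\<close>

lemma fst_copy_hypergraph: "fst (copy_hypergraph H n) = {e. e \<subseteq> {..<n} \<and> card e = 2}"
  by (simp add: copy_hypergraph_def complete_graph_def)

lemma board_copy_hypergraph:
  "finite (fst (copy_hypergraph H n))" "card (fst (copy_hypergraph H n)) = n choose 2"
  unfolding fst_copy_hypergraph using n_subsets[of "{..<n}" 2] by auto

lemma winning_sets_copy_hypergraph:
  assumes "simple_graph H"
  shows "snd (copy_hypergraph H n) = {(\<lambda>e. f ` e) ` snd H | f. inj_on f (fst H) \<and> f ` fst H \<subseteq> {..<n}}"
proof (intro set_eqI iffI)
  fix F assume "F \<in> snd (copy_hypergraph H n)"
  then obtain G where G: "F = snd G" "subgraph G (complete_graph n)" "isomorphic H G"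
    by (auto simp: copy_hypergraph_def)
  then obtain f where "bij_betw f (fst H) (fst G)" "snd G = (\<lambda>e. f ` e) ` snd H"
    by (auto simp: isomorphic_def)
  then show "F \<in> {(\<lambda>e. f ` e) ` snd H | f. inj_on f (fst H) \<and> f ` fst H \<subseteq> {..<n}}"
    using G(1,2)
    by (intro CollectI exI[of _ f]) (auto simp: bij_betw_def subgraph_def complete_graph_def)
next
  fix F assume "F \<in> {(\<lambda>e. f ` e) ` snd H | f. inj_on f (fst H) \<and> f ` fst H \<subseteq> {..<n}}"
  then obtain f where f: "inj_on f (fst H)" "f ` fst H \<subseteq> {..<n}" and F: "F = (\<lambda>e. f ` e) ` snd H"
    by blast
  define G where "G = (f ` fst H, F)"
  have e: "e \<subseteq> fst H \<and> card e = 2" if "e \<in> snd H" for e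
    using assms that by (simp add: simple_graph_def)
  have card: "card (f ` e) = 2" if "e \<in> snd H" for e
    using e[OF that] f(1) by (metis card_image inj_on_subset)
  have sub: "f ` e \<subseteq> f ` fst H" if "e \<in> snd H" for e
    using e[OF that] by (intro image_mono) auto
  then have "f ` e \<subseteq> {..<n}" if "e \<in> snd H" for e
    using that f(2) by blast
  then have "subgraph G (complete_graph n)"
    using assms f(2) sub card
    by (simp add: subgraph_def simple_graph_def complete_graph_def G_def F image_subset_iff)
  moreover have "isomorphic H G"
    unfolding isomorphic_def using f(1) by (intro exI[of _ f]) (simp add: bij_betw_def G_def F)
  ultimately show "F \<in> snd (copy_hypergraph H n)"
    by (auto simp: copy_hypergraph_def G_def intro!: exI[of _ G])
qed

lemma winning_sets_subset_board:
  "F \<in> snd (copy_hypergraph H n) \<Longrightarrow> F \<subseteq> fst (copy_hypergraph H n)"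
  by (auto simp: copy_hypergraph_def subgraph_def complete_graph_def)

text \<open>Serves both players: \<open>Z\<close> is the image of \<open>W\<close> under a fixed
  embedding in Maker's codegrees, and the vertex set of a chain in Breaker's count of
  extensions.\<close>

lemma card_constrained_maps:
  assumes "finite V" "W \<subseteq> V" "finite Z"
  shows "card {f \<in> V \<rightarrow>\<^sub>E {..<n}. f ` W \<subseteq> Z} \<le> card Z ^ card W * n ^ (card V - card W)"
proof -
  define T where "T u = (if u \<in> W then Z else {..<n})" for u
  have "finite W" using assms finite_subset by blast
  have "card {f \<in> V \<rightarrow>\<^sub>E {..<n}. f ` W \<subseteq> Z} \<le> card (Pi\<^sub>E V T)"
    using assms by (intro card_mono finite_PiE) (auto simp: T_def PiE_def Pi_def extensional_def)
  also have "\<dots> = (\<Prod>u\<in>V. card (T u))" using assms(1) by (rule card_PiE)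
  also have "\<dots> = (\<Prod>u\<in>W. card (T u)) * (\<Prod>u\<in>V - W. card (T u))"
    using assms prod.subset_diff[of W V "\<lambda>u. card (T u)"] by (simp add: mult.commute)
  also have "\<dots> = card Z ^ card W * n ^ card (V - W)" by (simp add: T_def)
  also have "card (V - W) = card V - card W" using \<open>finite W\<close> assms(2) by (rule card_Diff_subset)
  finally show ?thesis .
qed

text \<open>The maps are extensional: values outside \<open>V\<close> are fixed, so each injection
  is counted once and the set is finite.\<close>

definition embeddings :: "'v set \<Rightarrow> nat \<Rightarrow> ('v \<Rightarrow> nat) set" where
  "embeddings V n = {f \<in> V \<rightarrow>\<^sub>E {..<n}. inj_on f V}"

lemma finite_embeddings: "finite V \<Longrightarrow> finite (embeddings V n)"
  unfolding embeddings_def by (rule finite_subset[OF _ finite_PiE[of V "\<lambda>_. {..<n}"]]) auto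

lemma card_embeddings_le:
  assumes "finite V"
  shows "card (embeddings V n) \<le> n ^ card V"
proof -
  have "card (embeddings V n) \<le> card (V \<rightarrow>\<^sub>E {..<n})"
    using assms by (intro card_mono finite_PiE) (auto simp: embeddings_def)
  then show ?thesis using assms by (simp add: card_funcsetE)
qed

lemma card_embeddings_ge:
  assumes "finite V" "V \<noteq> {}" "card V \<le> n"
  shows "(real n / (2 * card V)) ^ card V \<le> real (card (embeddings V n))"
proof -
  define k where "k = n div card V"
  have v0: "0 < card V" using assms by (simp add: card_gt_0_iff)
  obtain h where h: "bij_betw h V {0..<card V}"
    using ex_bij_betw_finite_nat[OF assms(1)] by blast
  \<comment> \<open>Sending each vertex into a block of its own makes every choice of images injective.\<close>
  define T where "T u = {h u * k..<Suc (h u) * k}" for u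
  have hlt: "h u < card V" if "u \<in> V" for u using h that by (auto simp: bij_betw_def)
  have "Pi\<^sub>E V T \<subseteq> embeddings V n"
  proof
    fix f assume f: "f \<in> Pi\<^sub>E V T"
    have div: "f u div k = h u" if "u \<in> V" for u
    proof -
      have "h u * k \<le> f u" "f u < Suc (h u) * k" using f that by (auto simp: T_def PiE_def Pi_def)
      then show ?thesis by (metis div_nat_eqI mult.commute)
    qed
    have "f u < n" if "u \<in> V" for u
    proof -
      have "f u < Suc (h u) * k" using f that by (auto simp: T_def PiE_def Pi_def)
      also have "\<dots> \<le> card V * k" using hlt[OF that] by (intro mult_right_mono) auto
      also have "\<dots> \<le> n" by (simp add: k_def)
      finally show ?thesis .
    qed
    moreover have "inj_on f V"
      using h div by (metis (no_types, lifting) bij_betw_def inj_on_def)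
    ultimately show "f \<in> embeddings V n" using f by (auto simp: embeddings_def PiE_def)
  qed
  then have "card (Pi\<^sub>E V T) \<le> card (embeddings V n)"
    by (intro card_mono finite_embeddings assms)
  moreover have "card (Pi\<^sub>E V T) = k ^ card V" using assms(1) by (simp add: card_PiE T_def)
  ultimately have "real k ^ card V \<le> real (card (embeddings V n))"
    by (metis of_nat_le_iff of_nat_power)
  \<comment> \<open>Since \<open>k \<ge> 1\<close>, the remainder of the division is absorbed by
    doubling.\<close>
  moreover have "real n / (2 * card V) \<le> real k"
  proof -
    have "1 \<le> k" using v0 assms(3) by (simp add: k_def div_greater_zero_iff Suc_le_eq)
    have "n = k * card V + n mod card V" by (simp add: k_def)
    also have "\<dots> \<le> k * card V + card V" using v0 by (simp add: less_imp_le)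
    also have "\<dots> \<le> k * card V + k * card V" using \<open>1 \<le> k\<close> by simp
    finally have "n \<le> 2 * card V * k" by (simp add: algebra_simps)
    then have "real n \<le> 2 * card V * k" by (metis of_nat_le_iff of_nat_mult of_nat_numeral)
    then show ?thesis using v0 by (simp add: field_simps)
  qed
  ultimately show ?thesis
    using power_mono[of "real n / (2 * card V)" "real k" "card V"] by (smt (verit) divide_nonneg_nonneg of_nat_0_le_iff)
qed

lemma embeddings_extend:
  assumes "f \<in> embeddings V n" "V \<noteq> {}" "A \<subseteq> V" shows "card (f ` A) = card A" "f ` V \<subseteq> {..<n}"
  using assms by (auto simp: embeddings_def intro!: card_image intro: inj_on_subset)

text \<open>Containers are applied to all embeddings of \<open>H\<close> with q = n^(-1/m2). By
  \<open>big\<close>, the share of each container after \<open>s\<close> stages still exceeds the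
  fingerprint size \<open>m\<close>, after the price for the logarithm of the number of containers;
  so Maker's board hits every container often enough.\<close>

lemma maker_ensures_copy:
  fixes H :: "'v graph" and \<eta> :: real
  defines "v \<equiv> card (fst H)" and "r \<equiv> card (snd H)"
  assumes H: "simple_graph H" "2 \<le> e_num H" and n: "v \<le> n" and b: "b \<ge> 1" and \<eta>: "0 < \<eta>" "\<eta> \<le> 1"
    and N: "N = n choose 2" and m: "4 * n powr (- 1 / m2 H) * real N \<le> real m"
    and big: "real m < N / (2 * (2 ^ (r + 2) + 1) ^ r * (2 * real v ^ 2) ^ v) / ((real b + 1) * (1 + \<eta>)) ^ s
      - 4 / \<eta> * (ln r + r * (m * ln (real N + 1)))"
  shows "maker_ensures b (copy_hypergraph H n) s"
proof -
  define V where "V = fst H"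
  define d where "d = m2 H"
  define q where "q = real n powr (- 1 / d)"
  define B where "B = fst (copy_hypergraph H n)"
  have d0: "0 < d" using m2_ge_half[OF H] by (simp add: d_def)
  have finV: "finite V" using H(1) by (simp add: simple_graph_def V_def)
  note E = edges_card_Union[OF H(1) subset_refl]
  have r2: "2 \<le> r" using H(2) by (simp add: e_num_def r_def)
  have v3: "3 \<le> v"
  proof -
    have "3 \<le> card (\<Union>(snd H))" using edges_card_Union_ge_3[OF H(1) subset_refl] r2 by (simp add: r_def)
    also have "\<dots> \<le> v" unfolding v_def using E(2) finV by (intro card_mono) (auto simp: V_def)
    finally show ?thesis .
  qed
  then have n3: "3 \<le> n" using n by linarith
  then have q0: "0 < q" by (simp add: q_def)
  \<comment> \<open>Makes \<open>c * q\<close> equal to v^v n^(v - 2), the bound for embeddings that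
    use a given edge at a given position.\<close>
  define c where "c = real v ^ v * real n powr (real v - 2) / q"
  have c0: "0 < c" using q0 v3 n3 by (simp add: c_def)
  obtain es where es: "set es = snd H" "distinct es" "length es = r"
    using finite_distinct_list[OF E(1)] distinct_card by (metis r_def)
  define el where "el f i = f ` (es ! i)" for f :: "'v \<Rightarrow> nat" and i
  define \<Omega> where "\<Omega> = embeddings V n"
  have fin\<Omega>: "finite \<Omega>" unfolding \<Omega>_def by (rule finite_embeddings[OF finV])
  have Vne: "V \<noteq> {}" using v3 by (auto simp: v_def V_def)
  have \<Omega>ge: "(real n / (2 * v)) ^ v \<le> real (card \<Omega>)"
    using card_embeddings_ge[OF finV Vne, of n] n by (simp add: \<Omega>_def v_def V_def)
  have "0 < (real n / (2 * v)) ^ v" using n3 v3 by (intro zero_less_power divide_pos_pos) auto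
  then have \<Omega>ne: "\<Omega> \<noteq> {}" using \<Omega>ge by auto
  have finB: "finite B" and cardB: "card B = N"
    using board_copy_hypergraph[of H n] N by (simp_all add: B_def)
  have esE: "es ! i \<in> snd H" if "i < r" for i
    using nth_mem[of i es] es(1,3) that by simp
  have elB: "el f i \<in> B" if "f \<in> \<Omega>" "i < r" for f i
  proof -
    have sub: "es ! i \<subseteq> V" "card (es ! i) = 2"
      using esE[OF that(2)] H(1) by (auto simp: V_def simple_graph_def)
    then show ?thesis
      using embeddings_extend[OF that(1)[unfolded \<Omega>_def] Vne sub(1)]
      by (auto simp: B_def fst_copy_hypergraph el_def)
  qed
  have spr: "spread el {0..<r} c q \<Omega>"
    unfolding spread_def
  proof (intro allI impI ballI)
    fix A f assume A: "A \<subseteq> {0..<r}" "A \<noteq> {}" and f: "f \<in> \<Omega>"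
    define S where "S = (!) es ` A"
    define W where "W = \<Union>S"
    define w where "w = card W"
    have finA: "finite A" using A finite_subset by blast
    have S: "S \<subseteq> snd H" using A esE by (auto simp: S_def)
    note SU = edges_card_Union[OF H(1) S]
    have cardS: "card S = card A"
      unfolding S_def using A es by (intro card_image inj_on_nth) auto
    have WV: "W \<subseteq> V" using SU(2) by (simp add: W_def V_def)
    have wv: "w \<le> v" unfolding w_def v_def using WV finV by (intro card_mono) (auto simp: V_def)
    have A1: "1 \<le> card A" using A finA by (simp add: Suc_le_eq card_gt_0_iff)
    \<comment> \<open>\<open>m2_upper\<close> needs two edges; for a single edge both sides
      vanish.\<close>
    have key: "real (card A) - 1 \<le> d * (real w - 2)"
    proof (cases "card A = 1")
      case True
      then obtain e where "S = {e}" using cardS card_1_singletonE by metis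
      then have "w = 2" using SU(4)[of e] by (simp add: w_def W_def)
      then show ?thesis using True by simp
    next
      case False
      then show ?thesis using m2_upper[OF H(1) S] cardS A1 by (simp add: d_def w_def W_def)
    qed
    \<comment> \<open>Agreement means equal images of edges as sets, not equality on vertices. Hence
      \<open>g\<close> is confined on \<open>W\<close> only to the image of \<open>W\<close> under
      \<open>f\<close>, which costs the constant w^w \<le> v^v.\<close>
    have "{g \<in> \<Omega>. agree el A f g} \<subseteq> {g \<in> V \<rightarrow>\<^sub>E {..<n}. g ` W \<subseteq> f ` W}"
    proof
      fix g assume g: "g \<in> {g \<in> \<Omega>. agree el A f g}"
      have "g ` e = f ` e" if "e \<in> S" for e
        using that g by (auto simp: S_def agree_def el_def)
      then have "g ` W = f ` W" unfolding W_def by (simp add: image_Union)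
      then show "g \<in> {g \<in> V \<rightarrow>\<^sub>E {..<n}. g ` W \<subseteq> f ` W}"
        using g by (auto simp: \<Omega>_def embeddings_def)
    qed
    then have "card {g \<in> \<Omega>. agree el A f g} \<le> card {g \<in> V \<rightarrow>\<^sub>E {..<n}. g ` W \<subseteq> f ` W}"
      using finV by (intro card_mono) (auto intro: finite_subset[OF _ finite_PiE[of V "\<lambda>_. {..<n}"]])
    also have "\<dots> \<le> card (f ` W) ^ card W * n ^ (card V - card W)"
      using finV WV finite_subset by (intro card_constrained_maps) auto
    also have "\<dots> = w ^ w * n ^ (v - w)"
      using embeddings_extend(1)[OF f[unfolded \<Omega>_def] Vne WV] by (simp add: w_def v_def V_def)
    also have "\<dots> \<le> v ^ v * n ^ (v - w)"
    proof (rule mult_right_mono)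
      have "w ^ w \<le> v ^ w" using wv by (intro power_mono) auto
      also have "\<dots> \<le> v ^ v" using wv v3 by (intro power_increasing) auto
      finally show "w ^ w \<le> v ^ v" .
    qed simp
    finally have "real (card {g \<in> \<Omega>. agree el A f g}) \<le> real v ^ v * real n ^ (v - w)"
      by (metis of_nat_le_iff of_nat_mult of_nat_power)
    also have "real n ^ (v - w) = real n powr (real v - real w)"
      using n3 wv by (simp add: powr_realpow[symmetric])
    also have "real v ^ v * real n powr (real v - real w)
        \<le> real v ^ v * (real n powr (real v - 2) * real n powr (- (real (card A) - 1) / d))"
    proof (rule mult_left_mono)
      have "(real (card A) - 1) / d \<le> real w - 2" using key d0 by (simp add: field_simps)
      then have "real v - real w \<le> real v - 2 + - (real (card A) - 1) / d"
        unfolding minus_divide_left[symmetric] by linarith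
      then show "real n powr (real v - real w)
          \<le> real n powr (real v - 2) * real n powr (- (real (card A) - 1) / d)"
        unfolding powr_add[symmetric] using n3 by (intro powr_mono) auto
    qed simp
    also have "real n powr (- (real (card A) - 1) / d) = q ^ card A / q"
    proof -
      have "q ^ card A = q powr real (card A)" using q0 by (simp add: powr_realpow)
      also have "\<dots> = real n powr (- real (card A) / d)" by (simp add: q_def powr_powr)
      finally have eq: "q ^ card A = real n powr (- real (card A) / d)" .
      have "- (real (card A) - 1) / d = - real (card A) / d - - 1 / d"
        by (simp add: diff_divide_distrib)
      then show ?thesis unfolding eq unfolding q_def by (simp only: powr_diff)
    qed
    finally show "real (card {g \<in> \<Omega>. agree el A f g}) \<le> c * q ^ card A"
      by (simp add: c_def)
  qed
  \<comment> \<open>The quotient of v^v n^v by the lower bound (n / (2 v))^v for the number of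
    embeddings.\<close>
  define \<Lambda> where "\<Lambda> = (2 * real v ^ 2) ^ v"
  have \<Lambda>: "c * q * card B \<le> \<Lambda> * card \<Omega>"
  proof -
    have Nn: "real N \<le> real n powr 2"
    proof -
      have "N \<le> n ^ 2" using binomial_le_pow2[of n 2] binomial_le_pow[of 2 n] n3 N by simp
      then have "real N \<le> real n ^ 2" by (metis of_nat_le_iff of_nat_power)
      then show ?thesis by simp
    qed
    have "c * q * card B = real v ^ v * real n powr (real v - 2) * real N"
      using q0 by (simp add: c_def cardB)
    also have "\<dots> \<le> real v ^ v * real n powr (real v - 2) * real n powr 2"
      using Nn by (intro mult_left_mono) auto
    also have "\<dots> = real v ^ v * real n ^ v"
    proof -
      have "real n powr (real v - 2) * real n powr 2 = real n powr real v"
        unfolding powr_add[symmetric] by simp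
      also have "\<dots> = real n ^ v" using n3 by (intro powr_realpow) auto
      finally show ?thesis by simp
    qed
    also have "\<dots> = \<Lambda> * (real n / (2 * v)) ^ v"
    proof -
      have "real v * real n = 2 * real v ^ 2 * (real n / (2 * v))"
        using v3 by (simp add: power2_eq_square)
      then show ?thesis unfolding \<Lambda>_def power_mult_distrib[symmetric] by (rule arg_cong)
    qed
    also have "\<dots> \<le> \<Lambda> * card \<Omega>" using \<Omega>ge by (intro mult_left_mono) (auto simp: \<Lambda>_def)
    finally show ?thesis .
  qed
  have m': "4 * q * card B \<le> real m" using m by (simp add: q_def d_def cardB)
  obtain \<D> where \<D>: "finite \<D>" "real (card \<D>) \<le> real r * ((card B + 1) ^ m) ^ r"
    "\<And>D. D \<in> \<D> \<Longrightarrow> D \<subseteq> B"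
    "\<And>D. D \<in> \<D> \<Longrightarrow> real (card B) / (2 * (2 ^ (r + 2) + 1) ^ r * \<Lambda>) \<le> real (card D)"
    "\<forall>X. (\<forall>D\<in>\<D>. m < card (X \<inter> D)) \<longrightarrow> (\<exists>f\<in>\<Omega>. \<forall>i<r. el f i \<in> X)"
    by (rule container_family[of \<Omega> B r el c q \<Lambda> m, OF fin\<Omega> finB \<Omega>ne elB spr q0 c0 \<Lambda> m'],
        assumption, assumption, rule that)
  define \<mu> where "\<mu> = real (card B) / (2 * (2 ^ (r + 2) + 1) ^ r * \<Lambda>)"
  have \<mu>0: "0 \<le> \<mu>" by (simp add: \<mu>_def \<Lambda>_def)
  obtain \<sigma> where \<sigma>: "maker_strategy b (copy_hypergraph H n) \<sigma>"
    "\<And>p D. play b (copy_hypergraph H n) p \<Longrightarrow> follows \<sigma> p \<Longrightarrow> length p \<le> s \<Longrightarrow> D \<in> \<D> \<Longrightarrow>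
      \<mu> / ((real b + 1) * (1 + \<eta>)) ^ s - 4 / \<eta> * ln (card \<D>)
        \<le> real (card (D \<inter> fst (after_stages (copy_hypergraph H n) p)))"
  proof (rule maker_keeps_fair_share[of "copy_hypergraph H n" \<D> b \<eta> \<mu> s])
    show "finite (fst (copy_hypergraph H n))" using finB by (simp add: B_def)
    show "D \<subseteq> fst (copy_hypergraph H n)" if "D \<in> \<D>" for D using \<D>(3) that by (simp add: B_def)
    show "\<mu> \<le> real (card D)" if "D \<in> \<D>" for D using \<D>(4) that by (simp add: \<mu>_def)
  qed (use \<D>(1) b \<eta> \<mu>0 in auto)
  have "snd (after_stages (copy_hypergraph H n) p) \<noteq> {}"
    if p: "play b (copy_hypergraph H n) p" "follows \<sigma> p" "length p \<le> s" for p
  proof -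
    define X where "X = fst (after_stages (copy_hypergraph H n) p)"
    have "m < card (X \<inter> D)" if D: "D \<in> \<D>" for D
    proof -
      have pos: "0 < real (card \<D>)" using D \<D>(1) by (auto simp: card_gt_0_iff)
      have "ln (card \<D>) \<le> ln (real r * ((card B + 1) ^ m) ^ r)"
        using \<D>(2) pos by simp
      also have "\<dots> = ln r + r * (m * ln (real N + 1))"
        using r2 by (simp add: ln_mult ln_realpow cardB add.commute)
      finally have "4 / \<eta> * ln (card \<D>) \<le> 4 / \<eta> * (ln r + r * (m * ln (real N + 1)))"
        using \<eta> by (intro mult_left_mono) auto
      then have "real m < \<mu> / ((real b + 1) * (1 + \<eta>)) ^ s - 4 / \<eta> * ln (card \<D>)"
        using big by (simp add: \<mu>_def \<Lambda>_def cardB)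
      also have "\<dots> \<le> real (card (D \<inter> X))" unfolding X_def by (rule \<sigma>(2)[OF p D])
      finally show ?thesis by (simp add: Int_commute)
    qed
    then obtain f where f: "f \<in> \<Omega>" "\<forall>i<r. el f i \<in> X" using \<D>(5) by blast
    define F where "F = (\<lambda>e. f ` e) ` snd H"
    have "F \<subseteq> X"
    proof -
      have "f ` e \<in> X" if "e \<in> snd H" for e
        using that f(2) es unfolding el_def by (metis in_set_conv_nth)
      then show ?thesis by (auto simp: F_def)
    qed
    moreover have "F \<in> snd (copy_hypergraph H n)"
      unfolding winning_sets_copy_hypergraph[OF H(1)] F_def
      using f(1) embeddings_extend(2)[OF f(1)[unfolded \<Omega>_def] Vne subset_refl]
      by (auto simp: \<Omega>_def embeddings_def V_def)
    ultimately show ?thesis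
      using winning_sets_after_stages[OF p(1) winning_sets_subset_board]
      by (auto simp: X_def)
  qed
  then show ?thesis using \<sigma>(1) unfolding maker_ensures_def by blast
qed

section \<open>Expected numbers of chains of copies\<close>

lemma chain_unions_subset: "U \<in> chain_unions \<G> k \<Longrightarrow> U \<subseteq> \<Union>\<G>"
proof (induction k arbitrary: U)
  case (Suc k)
  then obtain U' F where U: "U = U' \<union> F" "U' \<in> chain_unions \<G> k" "F \<in> \<G>"
    unfolding chain_unions.simps by blast
  show ?case using Suc.IH[OF U(2)] U(1,3) by auto
qed auto

text \<open>A new link \<open>F\<close> contributes only its new elements, p^|U \<union> F| = p^|U|
  p^|F - U|, so each of the \<open>K\<close> extensions costs a factor \<open>B\<close>. The first
  set is estimated by 1, which gives the factor \<open>card \<G>\<close>; a union arising from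
  several pairs is merely overcounted.\<close>

lemma sum_chain_unions:
  fixes p B :: real
  assumes fin: "finite \<G>" "\<And>F. F \<in> \<G> \<Longrightarrow> finite F" and p: "0 \<le> p" "p \<le> 1" and B: "0 \<le> B"
    and ext: "\<And>k U. k < K \<Longrightarrow> U \<in> chain_unions \<G> k \<Longrightarrow>
      (\<Sum>F | F \<in> \<G> \<and> U \<inter> F \<noteq> {} \<and> \<not> F \<subseteq> U. p ^ card (F - U)) \<le> B"
  shows "(\<Sum>U\<in>chain_unions \<G> K. p ^ card U) \<le> card \<G> * B ^ K"
proof -
  have "(\<Sum>U\<in>chain_unions \<G> k. p ^ card U) \<le> card \<G> * B ^ k" if "k \<le> K" for k
    using that
  proof (induction k)
    case 0
    have "(\<Sum>U\<in>\<G>. p ^ card U) \<le> (\<Sum>U\<in>\<G>. 1)"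
      using p by (intro sum_mono power_le_one) auto
    then show ?case by simp
  next
    case (Suc k)
    define C where "C = chain_unions \<G> k"
    define E where "E U = {F. F \<in> \<G> \<and> U \<inter> F \<noteq> {} \<and> \<not> F \<subseteq> U}" for U
    have finC: "finite C" unfolding C_def by (rule finite_chains[OF fin(1)])
    have finE: "finite (E U)" for U using fin(1) by (simp add: E_def)
    have finU: "finite U" if "U \<in> C" for U
      using chain_unions_subset[of U \<G> k] that fin by (auto simp: C_def intro: finite_subset)
    have "chain_unions \<G> (Suc k) = (\<lambda>(U, F). U \<union> F) ` (SIGMA U:C. E U)"
      unfolding chain_unions.simps C_def E_def by (rule set_eqI) (simp add: image_iff Bex_def, blast)
    then have "(\<Sum>U\<in>chain_unions \<G> (Suc k). p ^ card U)
        \<le> (\<Sum>x\<in>(SIGMA U:C. E U). p ^ card (case x of (U, F) \<Rightarrow> U \<union> F))"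
      using sum_image_le[of "SIGMA U:C. E U" "\<lambda>U. p ^ card U" "\<lambda>(U, F). U \<union> F"] finC finE p
      by (simp add: o_def)
    also have "\<dots> = (\<Sum>(U, F)\<in>(SIGMA U:C. E U). p ^ card (U \<union> F))"
      by (rule sum.cong) auto
    also have "\<dots> = (\<Sum>U\<in>C. \<Sum>F\<in>E U. p ^ card (U \<union> F))"
      using finC finE by (intro sum.Sigma[symmetric]) auto
    also have "\<dots> = (\<Sum>U\<in>C. p ^ card U * (\<Sum>F\<in>E U. p ^ card (F - U)))"
    proof (intro sum.cong refl)
      fix U assume U: "U \<in> C"
      have "p ^ card (U \<union> F) = p ^ card U * p ^ card (F - U)" if "F \<in> E U" for F
      proof -
        have "finite F" using that fin(2) by (simp add: E_def)
        then have "card (U \<union> (F - U)) = card U + card (F - U)"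
          using finU[OF U] by (intro card_Un_disjoint) auto
        then show ?thesis by (simp add: power_add)
      qed
      then show "(\<Sum>F\<in>E U. p ^ card (U \<union> F)) = p ^ card U * (\<Sum>F\<in>E U. p ^ card (F - U))"
        by (simp add: sum_distrib_left)
    qed
    also have "\<dots> \<le> (\<Sum>U\<in>C. p ^ card U * B)"
      using ext[of k] Suc.prems p by (intro sum_mono mult_left_mono) (auto simp: C_def E_def)
    also have "\<dots> = (\<Sum>U\<in>C. p ^ card U) * B" by (rule sum_distrib_right[symmetric])
    also have "\<dots> \<le> (card \<G> * B ^ k) * B"
      using Suc B by (intro mult_right_mono) (auto simp: C_def)
    finally show ?case by (simp add: mult_ac)
  qed
  then show ?thesis by simp
qed

text \<open>The embeddings that extend a chain are sorted by the set \<open>J\<close> of edges they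
  place in it. The vertices of \<open>J\<close> have boundedly many possible images and the others
  at most \<open>n\<close> each, while every edge outside \<open>J\<close> contributes a factor
  \<open>p\<close>; \<beta> bounds this product for all possible \<open>J\<close>.\<close>

lemma not_maker_ensures_copy:
  fixes H :: "'v graph" and \<beta> :: real
  assumes H: "simple_graph H" and S: "S \<subseteq> snd H" "2 \<le> card S" and b: "b \<ge> 1" and K: "K \<ge> 1"
    and p: "p = (1 / (real b + 1)) ^ s" and \<beta>0: "0 \<le> \<beta>"
    and \<beta>: "\<And>J. J \<subseteq> S \<Longrightarrow> J \<noteq> {} \<Longrightarrow> J \<noteq> S \<Longrightarrow>
      real n ^ (card (\<Union>S) - card (\<Union>J)) * p ^ (card S - card J) \<le> \<beta>"
    and small: "(real b + 1) ^ s * (real n ^ card (\<Union>S) *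
      (2 ^ card S * (2 * real K * card S) ^ card (\<Union>S) * \<beta>) ^ K) < 1"
  shows "\<not> maker_ensures b (copy_hypergraph H n) (s + Suc (K * card S))"
proof -
  define W where "W = \<Union>S"
  define a where "a = card S"
  define w where "w = card W"
  define img where "img f = (\<lambda>e. f ` e) ` S" for f :: "'v \<Rightarrow> nat"
  define \<Omega> where "\<Omega> = embeddings W n"
  define \<G> where "\<G> = img ` \<Omega>"
  note SU = edges_card_Union[OF H S(1)]
  have finW: "finite W" using SU(3) by (simp add: W_def)
  have fin\<Omega>: "finite \<Omega>" unfolding \<Omega>_def by (rule finite_embeddings[OF finW])
  have p0: "0 \<le> p" "p \<le> 1" unfolding p by (auto intro!: power_le_one)
  have a2: "2 \<le> a" using S(2) by (simp add: a_def)
  have inj_img: "inj_on (\<lambda>e. f ` e) S" if "f \<in> \<Omega>" for f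
    using that by (intro inj_on_image) (simp add: \<Omega>_def embeddings_def W_def)
  have card_img: "finite (img f) \<and> card (img f) = a" if "f \<in> \<Omega>" for f
    using inj_img[OF that] SU(1) by (simp add: img_def a_def card_image)
  have fin\<G>: "finite \<G>" "\<And>F. F \<in> \<G> \<Longrightarrow> finite F \<and> card F \<le> a" "\<And>F. F \<in> \<G> \<Longrightarrow> 2 \<le> card F"
    using fin\<Omega> card_img a2 by (auto simp: \<G>_def)
  have pairs: "card x = 2" if x: "x \<in> \<Union>\<G>" for x
  proof -
    obtain f e where f: "f \<in> \<Omega>" "e \<in> S" "x = f ` e" using x by (auto simp: \<G>_def img_def)
    have "inj_on f e"
      using f(1,2) by (auto simp: \<Omega>_def embeddings_def W_def intro: inj_on_subset)
    then show ?thesis using SU(4)[OF f(2)] f(3) by (simp add: card_image)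
  qed
  \<comment> \<open>2^a choices of \<open>J\<close>, at most (2 K a)^w ways to place its vertices
    among the at most 2 K a vertices of the chain, and \<beta> for the new part.\<close>
  define B where "B = 2 ^ a * (2 * real K * a) ^ w * \<beta>"
  have ext: "(\<Sum>F | F \<in> \<G> \<and> U \<inter> F \<noteq> {} \<and> \<not> F \<subseteq> U. p ^ card (F - U)) \<le> B"
    if k: "k < K" and U: "U \<in> chain_unions \<G> k" for k U
  proof -
    define Z where "Z = \<Union>U"
    have "finite U \<and> card U \<le> Suc k * a" by (rule chains_bounds[OF fin\<G>(1,2) U])
    moreover have "Suc k * a \<le> K * a" using k by (intro mult_right_mono) auto
    ultimately have finU: "finite U" and cardU: "card U \<le> K * a" by auto
    have U2: "card x = 2" if "x \<in> U" for x
      using pairs chain_unions_subset[OF U] that by blast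
    then have finx: "finite x" if "x \<in> U" for x using card.infinite[of x] that by fastforce
    have finZ: "finite Z" unfolding Z_def using finU finx by (rule finite_Union)
    have "card Z \<le> sum card U" unfolding Z_def using card_Union_le_sum_card by blast
    also have "\<dots> = 2 * card U" using U2 by simp
    finally have cardZ: "card Z \<le> 2 * K * a" using cardU by simp
    define I where "I = {f \<in> \<Omega>. U \<inter> img f \<noteq> {} \<and> \<not> img f \<subseteq> U}"
    \<comment> \<open>Meeting \<open>U\<close> makes this set nonempty, not lying in
      \<open>U\<close> makes it proper: exactly the range of the hypothesis on \<beta>.\<close>
    define Jf where "Jf f = {e \<in> S. f ` e \<in> U}" for f
    define \<J> where "\<J> = {J. J \<subseteq> S \<and> J \<noteq> {} \<and> J \<noteq> S}"
    have finI: "finite I" using fin\<Omega> by (simp add: I_def)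
    have fin\<J>: "finite \<J>" by (rule finite_subset[of _ "Pow S"]) (auto simp: \<J>_def SU(1))
    have Jf: "Jf ` I \<subseteq> \<J>" by (auto simp: Jf_def I_def \<J>_def img_def)
    have card_diff: "card (img f - U) = a - card (Jf f)" if "f \<in> \<Omega>" for f
    proof -
      have "img f - U = (\<lambda>e. f ` e) ` (S - Jf f)" by (auto simp: img_def Jf_def)
      moreover have "card ((\<lambda>e. f ` e) ` (S - Jf f)) = card (S - Jf f)"
        by (rule card_image) (rule inj_on_subset[OF inj_img[OF that] Diff_subset])
      moreover have "card (S - Jf f) = card S - card (Jf f)"
        using SU(1) by (intro card_Diff_subset) (auto simp: Jf_def)
      ultimately show ?thesis by (simp add: a_def)
    qed
    have "{F. F \<in> \<G> \<and> U \<inter> F \<noteq> {} \<and> \<not> F \<subseteq> U} = img ` I" by (auto simp: \<G>_def I_def)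
    then have "(\<Sum>F | F \<in> \<G> \<and> U \<inter> F \<noteq> {} \<and> \<not> F \<subseteq> U. p ^ card (F - U))
        \<le> (\<Sum>f\<in>I. p ^ card (img f - U))"
      using sum_image_le[OF finI, of "\<lambda>F. p ^ card (F - U)" img] p0 by (simp add: o_def)
    also have "\<dots> = (\<Sum>f\<in>I. p ^ (a - card (Jf f)))"
      using card_diff by (intro sum.cong) (auto simp: I_def)
    also have "\<dots> = (\<Sum>J\<in>\<J>. \<Sum>f | f \<in> I \<and> Jf f = J. p ^ (a - card (Jf f)))"
      using sum.group[OF finI fin\<J> Jf] by (rule sym)
    also have "\<dots> \<le> (\<Sum>J\<in>\<J>. (2 * real K * a) ^ w * \<beta>)"
    proof (rule sum_mono)
      fix J assume J: "J \<in> \<J>"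
      then have JS: "J \<subseteq> S" by (simp add: \<J>_def)
      define u where "u = card (\<Union>J)"
      have JW: "\<Union>J \<subseteq> W" using JS by (auto simp: W_def)
      have uw: "u \<le> w" unfolding u_def w_def using JW finW by (intro card_mono)
      have "{f. f \<in> I \<and> Jf f = J} \<subseteq> {f \<in> W \<rightarrow>\<^sub>E {..<n}. f ` \<Union>J \<subseteq> Z}"
        by (auto simp: I_def Jf_def Z_def \<Omega>_def embeddings_def)
      then have "card {f. f \<in> I \<and> Jf f = J} \<le> card {f \<in> W \<rightarrow>\<^sub>E {..<n}. f ` \<Union>J \<subseteq> Z}"
        using finW by (intro card_mono) (auto intro: finite_subset[OF _ finite_PiE[of W "\<lambda>_. {..<n}"]])
      also have "\<dots> \<le> card Z ^ u * n ^ (w - u)"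
        using card_constrained_maps[OF finW JW finZ] by (simp add: u_def w_def)
      finally have "real (card {f. f \<in> I \<and> Jf f = J}) \<le> real (card Z) ^ u * real n ^ (w - u)"
        by (metis of_nat_le_iff of_nat_mult of_nat_power)
      also have "\<dots> \<le> (2 * real K * a) ^ w * real n ^ (w - u)"
      proof (rule mult_right_mono)
        have "real (card Z) \<le> 2 * real K * a"
          using cardZ by (metis of_nat_le_iff of_nat_mult of_nat_numeral)
        then have "real (card Z) ^ u \<le> (2 * real K * a) ^ u" by (intro power_mono) auto
        also have "\<dots> \<le> (2 * real K * a) ^ w"
        proof (rule power_increasing[OF uw])
          have "1 \<le> 2 * K * a" using K a2 by (simp add: Suc_le_eq)
          then show "1 \<le> 2 * real K * a" by (metis of_nat_1 of_nat_le_iff of_nat_mult of_nat_numeral)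
        qed
        finally show "real (card Z) ^ u \<le> (2 * real K * a) ^ w" .
      qed simp
      finally have cnt: "real (card {f. f \<in> I \<and> Jf f = J}) \<le> (2 * real K * a) ^ w * real n ^ (w - u)" .
      have "(\<Sum>f | f \<in> I \<and> Jf f = J. p ^ (a - card (Jf f)))
          = real (card {f. f \<in> I \<and> Jf f = J}) * p ^ (a - card J)" by simp
      also have "\<dots> \<le> (2 * real K * a) ^ w * real n ^ (w - u) * p ^ (a - card J)"
        using cnt p0 by (intro mult_right_mono) auto
      also have "\<dots> = (2 * real K * a) ^ w * (real n ^ (w - u) * p ^ (a - card J))" by simp
      also have "\<dots> \<le> (2 * real K * a) ^ w * \<beta>"
        using \<beta>[of J] J by (intro mult_left_mono) (auto simp: \<J>_def u_def w_def W_def a_def)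
      finally show "(\<Sum>f | f \<in> I \<and> Jf f = J. p ^ (a - card (Jf f))) \<le> (2 * real K * a) ^ w * \<beta>" .
    qed
    also have "\<dots> = card \<J> * ((2 * real K * a) ^ w * \<beta>)" by simp
    also have "\<dots> \<le> 2 ^ a * ((2 * real K * a) ^ w * \<beta>)"
    proof (rule mult_right_mono)
      have "card \<J> \<le> card (Pow S)" using SU(1) by (intro card_mono) (auto simp: \<J>_def)
      also have "\<dots> = 2 ^ a" using SU(1) by (simp add: card_Pow a_def)
      finally show "real (card \<J>) \<le> 2 ^ a" by (metis of_nat_le_iff of_nat_numeral of_nat_power)
    qed (use \<beta>0 in auto)
    finally show ?thesis by (simp add: B_def mult.assoc)
  qed
  have B0: "0 \<le> B" using \<beta>0 by (simp add: B_def)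
  have "(\<Sum>U\<in>chain_unions \<G> K. p ^ card U) \<le> card \<G> * B ^ K"
    using sum_chain_unions[of \<G> p B K] fin\<G> p0 B0 ext by auto
  also have "\<dots> \<le> real n ^ w * B ^ K"
  proof (rule mult_right_mono)
    have "card \<G> \<le> card \<Omega>" unfolding \<G>_def by (rule card_image_le[OF fin\<Omega>])
    also have "\<dots> \<le> n ^ w" unfolding \<Omega>_def w_def by (rule card_embeddings_le[OF finW])
    finally show "real (card \<G>) \<le> real n ^ w" by (metis of_nat_le_iff of_nat_power)
  qed (use B0 in simp)
  finally have "(real b + 1) ^ s * (\<Sum>U\<in>chain_unions \<G> K. p ^ card U)
      \<le> (real b + 1) ^ s * (real n ^ w * B ^ K)" by (intro mult_left_mono) auto
  also have "\<dots> < 1" using small by (simp add: B_def w_def W_def a_def)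
  finally have few: "(real b + 1) ^ s *
      (\<Sum>U\<in>chain_unions \<G> K. ((1 / (real b + 1)) ^ s) ^ card U) < 1" by (simp only: p)
  \<comment> \<open>A copy of \<open>H\<close> contains the copy of \<open>S\<close> under the same
    map, so destroying the copies of \<open>S\<close> is enough.\<close>
  have win: "F \<subseteq> fst (copy_hypergraph H n) \<and> (\<exists>G\<in>\<G>. G \<subseteq> F)" if F: "F \<in> snd (copy_hypergraph H n)" for F
  proof
    show "F \<subseteq> fst (copy_hypergraph H n)" by (rule winning_sets_subset_board[OF F])
    obtain f where f: "inj_on f (fst H)" "f ` fst H \<subseteq> {..<n}" "F = (\<lambda>e. f ` e) ` snd H"
      using F unfolding winning_sets_copy_hypergraph[OF H] by blast
    have WH: "W \<subseteq> fst H" using SU(2) by (simp add: W_def)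
    have "restrict f W \<in> \<Omega>"
      using f(1,2) WH by (auto simp: \<Omega>_def embeddings_def intro: inj_on_subset)
    moreover have "img (restrict f W) \<subseteq> F"
    proof -
      have "restrict f W ` e = f ` e" if "e \<in> S" for e using that by (auto simp: W_def)
      then show ?thesis using f(3) S(1) by (auto simp: img_def)
    qed
    ultimately show "\<exists>G\<in>\<G>. G \<subseteq> F" by (auto simp: \<G>_def)
  qed
  show ?thesis
    using breaker_wins[OF board_copy_hypergraph(1) b fin\<G>(1,2,3) win few] by (simp add: a_def)
qed

section \<open>Asymptotics\<close>

text \<open>Extracts what the proof uses of subpolynomiality: rounding up a number of stages costs
  little, and additive constants are negligible against the logarithm.\<close>

lemma subpolynomial_log_large:
  assumes b: "\<And>n. b n \<ge> (1::nat)" and sub: "subpolynomial (\<lambda>n. real (b n))" and "0 < \<epsilon>"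
  shows "\<forall>\<^sub>F n in at_top. real (b n) + 1 \<le> real n powr \<epsilon> \<and>
    1 / \<epsilon> \<le> log (real (b n) + 1) (real n)"
proof -
  have "(\<lambda>n. real (b n)) \<in> o(\<lambda>n. real n powr \<epsilon>)"
    using sub \<open>0 < \<epsilon>\<close> by (simp add: subpolynomial_def)
  then have "\<forall>\<^sub>F n in at_top. norm (real (b n)) \<le> 1 / 2 * norm (real n powr \<epsilon>)"
    by (rule landau_o.smallD) simp
  then show ?thesis
    using eventually_ge_at_top[of 2]
  proof eventually_elim
    case (elim n)
    have b1: "1 \<le> real (b n)" using b[of n] by simp
    \<comment> \<open>The constant 1 / 2 above pays for b + 1 \<le> 2 b.\<close>
    have le: "real (b n) + 1 \<le> real n powr \<epsilon>" using elim b1 by simp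
    have "ln (real (b n) + 1) \<le> \<epsilon> * ln n"
      using le b1 elim(2) ln_mono[OF le] by (simp add: ln_powr)
    moreover have "0 < ln (real (b n) + 1)" using b1 by simp
    ultimately show ?case using le \<open>0 < \<epsilon>\<close> by (simp add: log_def field_simps)
  qed
qed

lemma filterlim_nat_powr_at_top:
  assumes "0 < (a :: real)"
  shows "filterlim (\<lambda>n :: nat. real n powr a) at_top at_top"
proof -
  have "filterlim (\<lambda>n :: nat. exp (a * ln (real n))) at_top at_top"
    using assms
    by (intro filterlim_compose[OF exp_at_top] filterlim_tendsto_pos_mult_at_top[OF tendsto_const]
        filterlim_compose[OF ln_at_top filterlim_real_sequentially])
  moreover have "\<forall>\<^sub>F n :: nat in at_top. exp (a * ln (real n)) = real n powr a"
    using eventually_gt_at_top[of 0] by eventually_elim (simp add: powr_def)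
  ultimately show ?thesis by (rule filterlim_cong[OF refl refl, THEN iffD1, rotated])
qed

lemma eventually_log_less_powr:
  fixes A B C e :: real
  assumes "0 \<le> A" "0 \<le> B" "0 < C" "0 < e"
  shows "\<forall>\<^sub>F n :: nat in at_top. A + B * ln n < C * n powr e"
proof -
  define D where "D = (A + B * (2 / e)) / C"
  have "filterlim (\<lambda>n :: nat. real n powr (e / 2)) at_top at_top"
    using assms(4) by (intro filterlim_nat_powr_at_top) simp
  then have "\<forall>\<^sub>F n :: nat in at_top. D < real n powr (e / 2)" by (simp add: filterlim_at_top_dense)
  then show ?thesis
    using eventually_ge_at_top[of 1]
  proof eventually_elim
    case (elim n)
    define y where "y = real n powr (e / 2)"
    have y1: "1 \<le> y" using elim(2) assms(4) by (simp add: y_def ge_one_powr_ge_zero)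
    have "ln n \<le> y / (e / 2)"
      unfolding y_def using elim(2) assms(4) by (intro ln_powr_bound) auto
    then have "A + B * ln n \<le> A * y + B * (y / (e / 2))"
      using assms y1 by (intro add_mono mult_left_mono) (auto simp: mult_le_cancel_left1)
    also have "\<dots> = C * (D * y)" using assms(3,4) by (simp add: D_def field_simps)
    also have "\<dots> < C * (y * y)"
      using elim(1) assms(3) y1 by (intro mult_strict_left_mono mult_strict_right_mono) (auto simp: y_def[symmetric])
    also have "y * y = n powr e" unfolding y_def powr_add[symmetric] by simp
    finally show ?case .
  qed
qed

text \<open>The share is of order n^2 divided by at most n^(1/m2 - \<epsilon>/2), while
  \<open>m\<close> is of order n^(2 - 1/m2). The surplus n^(\<epsilon>/2) beats the logarithm that
  comes from the number of containers.\<close>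

lemma maker_lower_bound:
  fixes H :: "'v graph" and b :: "nat \<Rightarrow> nat"
  assumes H: "simple_graph H" "e_num H \<ge> 2" and b: "\<And>n. b n \<ge> 1"
    and \<epsilon>: "0 < \<epsilon>" "\<epsilon> < 1 / m2 H"
  shows "\<forall>\<^sub>F n in at_top. maker_ensures (b n) (copy_hypergraph H n)
    (nat \<lfloor>(1 / m2 H - \<epsilon>) * log (real (b n) + 1) (real n)\<rfloor>)"
proof -
  define g where "g = 1 / m2 H"
  define r where "r = card (snd H)"
  define v where "v = card (fst H)"
  \<comment> \<open>As b + 1 \<ge> 2, the number of stages is at most g ln n / ln 2. With this
    \<eta> the accumulated loss (1 + \<eta>)^s is at most n^(\<epsilon>/2), half of the available
    surplus.\<close>
  define \<eta> where "\<eta> = min 1 (\<epsilon> * ln 2 / (2 * g))"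
  define \<delta> where "\<delta> = 1 / (2 * (2 ^ (r + 2) + 1) ^ r * (2 * real v ^ 2) ^ v)"
  have half: "1 / 2 \<le> m2 H" by (rule m2_ge_half[OF H])
  have g: "0 < g" "g \<le> 2" using half by (auto simp: g_def field_simps)
  have r2: "2 \<le> r" using H(2) by (simp add: r_def e_num_def)
  have "3 \<le> card (\<Union>(snd H))" using edges_card_Union_ge_3[OF H(1) subset_refl] r2 by (simp add: r_def)
  then have "card (\<Union>(snd H)) \<noteq> 0" by linarith
  then have "\<Union>(snd H) \<noteq> {}" by (metis card.empty)
  then have "fst H \<noteq> {}" using edges_card_Union(2)[OF H(1) subset_refl] by blast
  then have v0: "0 < v" using H(1) by (simp add: v_def simple_graph_def card_gt_0_iff)
  have \<eta>: "0 < \<eta>" "\<eta> \<le> 1" using \<epsilon>(1) g by (auto simp: \<eta>_def)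
  have "0 < (2 ^ (r + 2) + 1 :: real) ^ r" by (intro zero_less_power) (simp add: add_pos_pos)
  then have \<delta>0: "0 < \<delta>" using v0 by (simp add: \<delta>_def)
  have "\<forall>\<^sub>F n :: nat in at_top. (5 + 4 / \<eta> * ln r) + (4 / \<eta> * (10 * r)) * ln n < (\<delta> / 4) * n powr (\<epsilon> / 2)"
    using \<eta> r2 \<delta>0 \<epsilon>(1) by (intro eventually_log_less_powr) auto
  then show ?thesis
    using eventually_ge_at_top[of v] eventually_ge_at_top[of 2]
  proof eventually_elim
    case (elim n)
    define L where "L = log (real (b n) + 1) (real n)"
    define s where "s = nat \<lfloor>(g - \<epsilon>) * L\<rfloor>"
    define N where "N = n choose 2"
    define m where "m = nat \<lceil>4 * n powr (- g) * real N\<rceil>"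
    define y where "y = real n powr (2 - g)"
    have b1: "2 \<le> real (b n) + 1" using b[of n] by simp
    have n2: "2 \<le> real n" using elim(3) by simp
    have L0: "0 \<le> L" using b1 n2 unfolding L_def by (intro zero_le_log_cancel_iff[THEN iffD2]) auto
    have sL: "real s \<le> (g - \<epsilon>) * L"
      using L0 \<epsilon>(2) unfolding s_def g_def[symmetric] by (simp add: of_nat_floor)
    have Lln: "L * ln (real (b n) + 1) = ln n" using b1 by (simp add: L_def log_def)
    have "L * ln 2 \<le> L * ln (real (b n) + 1)" using b1 L0 by (intro mult_left_mono) auto
    then have L2: "L * ln 2 \<le> ln n" using Lln by simp
    have R: "((real (b n) + 1) * (1 + \<eta>)) ^ s \<le> n powr (g - \<epsilon> / 2)"
    proof -
      have "ln (((real (b n) + 1) * (1 + \<eta>)) ^ s) = s * ln (real (b n) + 1) + s * ln (1 + \<eta>)"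
      proof -
        have "ln ((real (b n) + 1) * (1 + \<eta>)) = ln (real (b n) + 1) + ln (1 + \<eta>)"
          using b1 \<eta> by (intro ln_mult_pos) auto
        moreover have "0 < (real (b n) + 1) * (1 + \<eta>)" using b1 \<eta> by (intro mult_pos_pos) auto
        ultimately show ?thesis by (simp only: ln_realpow distrib_left)
      qed
      also have "s * ln (real (b n) + 1) \<le> (g - \<epsilon>) * L * ln (real (b n) + 1)"
        using sL b1 by (intro mult_right_mono) auto
      also have "\<dots> = (g - \<epsilon>) * ln n" using Lln by simp
      also have "s * ln (1 + \<eta>) \<le> g * L * \<eta>"
      proof (intro mult_mono)
        show "real s \<le> g * L" using sL L0 \<epsilon>(1) by (smt (verit) mult_right_mono)
        show "ln (1 + \<eta>) \<le> \<eta>" using \<eta> by (intro ln_add_one_self_le_self) auto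
      qed (use g L0 \<eta> in auto)
      also have "\<dots> \<le> g * L * (\<epsilon> * ln 2 / (2 * g))"
        using g L0 by (intro mult_left_mono) (auto simp: \<eta>_def)
      also have "\<dots> = \<epsilon> / 2 * (L * ln 2)" using g by simp
      also have "\<dots> \<le> \<epsilon> / 2 * ln n" using L2 \<epsilon>(1) by (intro mult_left_mono) auto
      finally have "ln (((real (b n) + 1) * (1 + \<eta>)) ^ s) \<le> (g - \<epsilon> / 2) * ln n"
        by (simp add: algebra_simps)
      then have "ln (((real (b n) + 1) * (1 + \<eta>)) ^ s) \<le> ln (n powr (g - \<epsilon> / 2))"
        using n2 by (simp add: ln_powr)
      moreover have "0 < ((real (b n) + 1) * (1 + \<eta>)) ^ s"
        using b1 \<eta> by (intro zero_less_power mult_pos_pos) auto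
      moreover have "0 < n powr (g - \<epsilon> / 2)" using n2 by simp
      ultimately show ?thesis by (simp only: ln_le_cancel_iff)
    qed
    have N: "real N = real n * (real n - 1) / 2"
      using elim(3) by (simp add: N_def choose_two real_of_nat_div of_nat_diff)
    have Nlo: "real n ^ 2 / 4 \<le> real N"
    proof -
      have "real n * (real n / 2) \<le> real n * (real n - 1)" using n2 by (intro mult_left_mono) auto
      then show ?thesis by (simp add: N power2_eq_square)
    qed
    have Nhi: "real N + 1 \<le> real n ^ 2"
    proof -
      have "0 \<le> real n * real n" by simp
      then have "2 \<le> real n + real n * real n" using n2 by linarith
      then show ?thesis using n2 by (simp add: N power2_eq_square field_simps)
    qed
    have "real N \<le> real n ^ 2" using Nhi by linarith
    also have "real n ^ 2 = real n powr 2" using n2 by simp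
    finally have "real N \<le> real n powr 2" .
    then have "4 * n powr (- g) * real N \<le> 4 * n powr (- g) * real n powr 2"
      by (intro mult_left_mono) auto
    also have "\<dots> = 4 * (n powr (- g) * n powr 2)" by (rule mult.assoc)
    also have "n powr (- g) * n powr 2 = y"
      unfolding y_def powr_add[symmetric] by (simp only: add.commute diff_conv_add_uminus)
    finally have mle: "4 * n powr (- g) * real N \<le> 4 * y" .
    have y1: "1 \<le> y" unfolding y_def using n2 g by (intro ge_one_powr_ge_zero) auto
    \<comment> \<open>Rounding up adds at most 1 \<le> y.\<close>
    have m5: "real m \<le> 5 * y"
    proof -
      have "real m \<le> 4 * n powr (- g) * real N + 1"
        unfolding m_def by (simp add: of_nat_ceiling)
      then show ?thesis using mle y1 by linarith
    qed
    have lnN: "ln (real N + 1) \<le> 2 * ln n"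
    proof -
      have "ln (real N + 1) \<le> ln (real n ^ 2)" using Nhi by (intro ln_mono) auto
      then show ?thesis using n2 by (simp add: ln_realpow)
    qed
    \<comment> \<open>The coefficients 5 and 10 of the asymptotic inequality arise from m \<le> 5 y
      and from the factor 2 in ln (N + 1) \<le> 2 ln n.\<close>
    have "real m + 4 / \<eta> * (ln r + r * (m * ln (real N + 1)))
        \<le> 5 * y + 4 / \<eta> * (ln r * y + r * (5 * y * (2 * ln n)))"
    proof (intro add_mono mult_left_mono m5 mult_mono lnN)
      show "ln r \<le> ln r * y" using r2 y1 by (simp add: mult_le_cancel_left1)
    qed (use \<eta> y1 n2 in auto)
    also have "\<dots> = y * ((5 + 4 / \<eta> * ln r) + (4 / \<eta> * (10 * r)) * ln n)" by (simp add: algebra_simps)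
    also have "\<dots> < y * ((\<delta> / 4) * n powr (\<epsilon> / 2))"
      using elim(1) y1 by (intro mult_strict_left_mono) auto
    also have "\<dots> = \<delta> * (n ^ 2 / 4) / n powr (g - \<epsilon> / 2)"
    proof -
      have "y * n powr (\<epsilon> / 2) * n powr (g - \<epsilon> / 2) = n ^ 2"
        unfolding y_def powr_add[symmetric] using n2 by simp
      then show ?thesis using n2 by (simp add: field_simps)
    qed
    also have "\<dots> \<le> \<delta> * N / n powr (g - \<epsilon> / 2)"
      using Nlo \<delta>0 by (intro divide_right_mono mult_left_mono) auto
    also have "\<dots> \<le> \<delta> * N / ((real (b n) + 1) * (1 + \<eta>)) ^ s"
      using R b1 n2 \<eta> \<delta>0 by (intro divide_left_mono mult_pos_pos zero_less_power) auto
    finally have big: "real m < N / (2 * (2 ^ (r + 2) + 1) ^ r * (2 * real v ^ 2) ^ v)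
        / ((real (b n) + 1) * (1 + \<eta>)) ^ s - 4 / \<eta> * (ln r + r * (m * ln (real N + 1)))"
      by (simp add: \<delta>_def)
    have "maker_ensures (b n) (copy_hypergraph H n) s"
    proof (rule maker_ensures_copy[OF H _ b \<eta> N_def])
      show "card (fst H) \<le> n" using elim(2) by (simp add: v_def)
      show "4 * real n powr (- 1 / m2 H) * real N \<le> real m"
        unfolding m_def g_def by (simp add: real_nat_ceiling_ge)
    qed (use big in \<open>simp add: r_def v_def\<close>)
    then show ?case by (simp add: s_def L_def g_def)
  qed
qed

text \<open>The chain length \<open>K\<close> depends only on \<open>H\<close>, \<open>S\<close> and
  \<epsilon>, so the stages needed for the clusters amount to a constant \<open>T\<close>
  independent of \<open>n\<close>.\<close>

lemma breaker_upper_bound: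
  fixes H :: "'v graph" and b :: "nat \<Rightarrow> nat"
  assumes H: "simple_graph H" "e_num H \<ge> 2" and b: "\<And>n. b n \<ge> 1"
    and sub: "subpolynomial (\<lambda>n. real (b n))" and \<epsilon>: "0 < \<epsilon>"
  obtains T where "\<forall>\<^sub>F n in at_top. \<not> maker_ensures (b n) (copy_hypergraph H n)
    (nat \<lceil>(1 / m2 H + \<epsilon>) * log (real (b n) + 1) (real n)\<rceil> + T)"
proof -
  obtain S where S: "S \<subseteq> snd H" "2 \<le> card S"
    and dS: "real (card S) - 1 = m2 H * (real (card (\<Union>S)) - 2)"
    using m2_attained[OF H] by blast
  define g where "g = 1 / m2 H"
  define w where "w = card (\<Union>S)"
  \<comment> \<open>(b + 1)^s contributes at most n^(g + \<epsilon> + 1), the first copy n^w, each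
    further copy n^(-\<epsilon>). This \<open>K\<close> leaves n^(-\<epsilon>) to spare against the
    constant \<open>C ^ K\<close>.\<close>
  define K where "K = nat \<lceil>(g + 2 * \<epsilon> + 1 + w) / \<epsilon>\<rceil>"
  define C where "C = 2 ^ card S * (2 * real K * card S) ^ w"
  have d0: "0 < m2 H" using m2_ge_half[OF H] by linarith
  then have g0: "0 < g" by (simp add: g_def)
  have "(g + 2 * \<epsilon> + 1 + w) / \<epsilon> \<le> real K" unfolding K_def by (rule real_nat_ceiling_ge)
  then have K: "g + 2 * \<epsilon> + 1 + w \<le> \<epsilon> * K" using \<epsilon> by (simp add: field_simps)
  then have "0 < \<epsilon> * K" using g0 \<epsilon> by (smt (verit) of_nat_0_le_iff)
  then have K1: "1 \<le> K" using \<epsilon> by (simp add: zero_less_mult_iff)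
  have C0: "0 \<le> C" by (simp add: C_def)
  \<comment> \<open>Subtracting \<open>m2_upper\<close> for \<open>J\<close> from the equality for
    \<open>S\<close> bounds the new vertices by \<open>g\<close> times the new edges. At least one
    edge is new, so the surplus \<epsilon> in the density gains n^(-\<epsilon>).\<close>
  have exponent: "(real w - real (card (\<Union>J))) - (g + \<epsilon>) * (real (card S) - real (card J)) \<le> - \<epsilon>"
    if J: "J \<subseteq> S" "J \<noteq> {}" "J \<noteq> S" for J
  proof -
    note SU = edges_card_Union[OF H(1) S(1)]
    have finJ: "finite J" using J(1) SU(1) finite_subset by blast
    have lt: "card J < card S" using J SU(1) by (intro psubset_card_mono) auto
    have "1 \<le> card J" using J(2) finJ by (simp add: Suc_le_eq card_gt_0_iff)
    have "real (card J) - 1 \<le> m2 H * (real (card (\<Union>J)) - 2)"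
    proof (cases "card J = 1")
      case True
      then obtain e where "J = {e}" using card_1_singletonE by blast
      then have "card (\<Union>J) = 2" using J(1) SU(4)[of e] by auto
      then show ?thesis using True by simp
    next
      case False
      then show ?thesis using \<open>1 \<le> card J\<close> J(1) S(1) by (intro m2_upper[OF H(1)]) auto
    qed
    then have "m2 H * (real w - real (card (\<Union>J))) \<le> real (card S) - real (card J)"
      using dS by (simp add: w_def algebra_simps)
    then have "real w - real (card (\<Union>J)) \<le> g * (real (card S) - real (card J))"
      using d0 by (simp add: g_def field_simps)
    moreover have "\<epsilon> * 1 \<le> \<epsilon> * (real (card S) - real (card J))"
      using lt \<epsilon> by (intro mult_left_mono) auto
    ultimately show ?thesis by (simp add: algebra_simps)
  qed
  have "filterlim (\<lambda>n :: nat. real n powr \<epsilon>) at_top at_top"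
    using \<epsilon> by (rule filterlim_nat_powr_at_top)
  then have "\<forall>\<^sub>F n :: nat in at_top. C ^ K < real n powr \<epsilon>" by (simp add: filterlim_at_top_dense)
  then have "\<forall>\<^sub>F n in at_top. \<not> maker_ensures (b n) (copy_hypergraph H n)
    (nat \<lceil>(g + \<epsilon>) * log (real (b n) + 1) (real n)\<rceil> + Suc (K * card S))"
    using subpolynomial_log_large[OF b sub, of 1, simplified] eventually_ge_at_top[of 2]
  proof eventually_elim
    case (elim n)
    define L where "L = log (real (b n) + 1) (real n)"
    define s where "s = nat \<lceil>(g + \<epsilon>) * L\<rceil>"
    define p where "p = (1 / (real (b n) + 1)) ^ s"
    have b1: "2 \<le> real (b n) + 1" using b[of n] by simp
    have n2: "2 \<le> real n" using elim(3) by simp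
    have L0: "0 \<le> L" using b1 n2 unfolding L_def by (intro zero_le_log_cancel_iff[THEN iffD2]) auto
    have pw: "(real (b n) + 1) powr (x * L) = n powr x" for x
    proof -
      have "(real (b n) + 1) powr (L * x) = ((real (b n) + 1) powr L) powr x" by (rule powr_powr[symmetric])
      also have "(real (b n) + 1) powr L = n" unfolding L_def using b1 n2 by (intro powr_log_cancel) auto
      finally show ?thesis by (simp add: mult.commute)
    qed
    have bs: "(real (b n) + 1) ^ s = (real (b n) + 1) powr real s" using b1 by (simp add: powr_realpow)
    have "(g + \<epsilon>) * L \<le> real s" unfolding s_def by (rule real_nat_ceiling_ge)
    then have lo: "n powr (g + \<epsilon>) \<le> (real (b n) + 1) ^ s"
      unfolding bs pw[symmetric] using b1 by (intro powr_mono) auto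
    \<comment> \<open>Rounding up costs one factor b + 1, which is at most n.\<close>
    have "real s \<le> (g + \<epsilon>) * L + 1"
      unfolding s_def using L0 g0 \<epsilon> by (simp add: of_nat_ceiling)
    then have "(real (b n) + 1) ^ s \<le> (real (b n) + 1) powr ((g + \<epsilon>) * L + 1)"
      unfolding bs using b1 by (intro powr_mono) auto
    also have "\<dots> = n powr (g + \<epsilon>) * (real (b n) + 1)" using b1 by (simp add: powr_add pw)
    also have "\<dots> \<le> n powr (g + \<epsilon>) * n powr 1" using elim(2) by (intro mult_left_mono) auto
    also have "\<dots> = n powr (g + \<epsilon> + 1)" by (rule powr_add[symmetric])
    finally have hi: "(real (b n) + 1) ^ s \<le> n powr (g + \<epsilon> + 1)" .
    have p0: "0 \<le> p" by (simp add: p_def)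
    have ple: "p \<le> n powr (- (g + \<epsilon>))"
    proof -
      have "p = 1 / (real (b n) + 1) ^ s" by (simp add: p_def power_one_over)
      also have "\<dots> \<le> 1 / n powr (g + \<epsilon>)" using lo n2 b1 by (intro divide_left_mono) auto
      finally show ?thesis by (simp only: powr_minus_divide)
    qed
    have "\<not> maker_ensures (b n) (copy_hypergraph H n) (s + Suc (K * card S))"
    proof (rule not_maker_ensures_copy[OF H(1) S b K1 p_def])
      show "0 \<le> n powr (- \<epsilon>)" by simp
    next
      fix J assume J: "J \<subseteq> S" "J \<noteq> {}" "J \<noteq> S"
      note SU = edges_card_Union[OF H(1) S(1)]
      have u: "card (\<Union>J) \<le> w" unfolding w_def using J(1) SU(3) by (intro card_mono) auto
      have j: "card J \<le> card S" using J(1) SU(1) by (intro card_mono) auto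
      have "real n ^ (w - card (\<Union>J)) * p ^ (card S - card J)
          \<le> real n ^ (w - card (\<Union>J)) * (n powr (- (g + \<epsilon>))) ^ (card S - card J)"
        using ple p0 by (intro mult_left_mono power_mono) auto
      also have "\<dots> = n powr (real w - real (card (\<Union>J))) *
          n powr (- (g + \<epsilon>) * (real (card S) - real (card J)))"
      proof (intro arg_cong2[of _ _ _ _ "(*)"])
        show "real n ^ (w - card (\<Union>J)) = n powr (real w - real (card (\<Union>J)))"
        using n2 u powr_realpow[of "real n" "w - card (\<Union>J)"] by (simp add: of_nat_diff)
        show "(n powr (- (g + \<epsilon>))) ^ (card S - card J)
          = n powr (- (g + \<epsilon>) * (real (card S) - real (card J)))"
        using n2 j powr_realpow[of "n powr (- (g + \<epsilon>))" "card S - card J"]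
        by (simp only: powr_powr of_nat_diff) simp
      qed
      also have "\<dots> = n powr ((real w - real (card (\<Union>J))) - (g + \<epsilon>) * (real (card S) - real (card J)))"
        unfolding powr_add[symmetric] by (simp only: mult_minus_left add_uminus_conv_diff)
      also have "\<dots> \<le> n powr (- \<epsilon>)" using exponent[OF J] n2 by (intro powr_mono) auto
      finally show "real n ^ (card (\<Union>S) - card (\<Union>J)) * p ^ (card S - card J) \<le> n powr (- \<epsilon>)"
        by (simp add: w_def)
    next
      have nK: "(n powr (- \<epsilon>)) ^ K = n powr (- \<epsilon> * K)"
        using n2 powr_realpow[of "n powr (- \<epsilon>)" K] by (simp add: powr_powr)
      have "(real (b n) + 1) ^ s * (real n ^ w * (C * n powr (- \<epsilon>)) ^ K)
          \<le> n powr (g + \<epsilon> + 1) * (real n ^ w * (C * n powr (- \<epsilon>)) ^ K)"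
        using hi C0 by (intro mult_right_mono) auto
      also have "\<dots> = C ^ K * (n powr (g + \<epsilon> + 1) * n powr w * n powr (- \<epsilon> * K))"
        using n2 by (simp add: power_mult_distrib nK powr_realpow)
      also have "n powr (g + \<epsilon> + 1) * n powr w * n powr (- \<epsilon> * K) = n powr (g + \<epsilon> + 1 + w - \<epsilon> * K)"
        unfolding powr_add[symmetric] by simp
      also have "C ^ K * \<dots> \<le> C ^ K * n powr (- \<epsilon>)"
        using K n2 C0 by (intro mult_left_mono powr_mono) auto
      also have "\<dots> < n powr \<epsilon> * n powr (- \<epsilon>)"
        using elim(1) n2 by (intro mult_strict_right_mono) auto
      also have "\<dots> = 1" unfolding powr_add[symmetric] using n2 by simp
      finally show "(real (b n) + 1) ^ s * (real n ^ card (\<Union>S) *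
          (2 ^ card S * (2 * real K * card S) ^ card (\<Union>S) * n powr (- \<epsilon>)) ^ K) < 1"
        by (simp add: C_def w_def)
    qed
    then show ?case by (simp add: s_def L_def)
  qed
  then show ?thesis using that unfolding g_def by blast
qed

theorem theorem1p4:
  fixes H :: "'v graph" and b :: "nat \<Rightarrow> nat"
  assumes "simple_graph H"
    and "e_num H \<ge> 2"
    and "\<And>n. b n \<ge> 1"
    and "subpolynomial (\<lambda>n. real (b n))"
  shows "\<exists>\<delta> :: nat \<Rightarrow> real. \<delta> \<in> o(\<lambda>_. 1) \<and>
    (\<forall>\<^sub>F n in at_top.
      real (threshold (copy_hypergraph H n) (b n)) =
        (1 / m2 H + \<delta> n) * log (real (b n) + 1) (real n))"
proof -
  define g where "g = 1 / m2 H"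
  define L where "L n = log (real (b n) + 1) (real n)" for n
  define \<tau> where "\<tau> n = threshold (copy_hypergraph H n) (b n)" for n
  define \<delta> where "\<delta> n = real (\<tau> n) / L n - g" for n
  have g0: "0 < g" using m2_ge_half[OF assms(1,2)] by (simp add: g_def)
  have "\<forall>\<^sub>F n in at_top. norm (\<delta> n) \<le> c * norm (1 :: real)" if c: "c > 0" for c
  proof -
    \<comment> \<open>Half of \<open>c\<close> goes to \<epsilon>, half to additive constants;
      \<open>g / 2\<close> secures \<epsilon> < 1 / m2 for Maker's bound.\<close>
    define \<epsilon> where "\<epsilon> = min (c / 2) (g / 2)"
    have \<epsilon>: "0 < \<epsilon>" "\<epsilon> \<le> c / 2" "\<epsilon> < g" using c g0 by (auto simp: \<epsilon>_def)
    obtain T where T: "\<forall>\<^sub>F n in at_top. \<not> maker_ensures (b n) (copy_hypergraph H n)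
        (nat \<lceil>(g + \<epsilon>) * L n\<rceil> + T)"
      using breaker_upper_bound[OF assms \<epsilon>(1)] unfolding g_def L_def by blast
    have low: "\<forall>\<^sub>F n in at_top. maker_ensures (b n) (copy_hypergraph H n) (nat \<lfloor>(g - \<epsilon>) * L n\<rfloor>)"
      using maker_lower_bound[of H b \<epsilon>] assms(1-3) \<epsilon>(1,3) unfolding g_def L_def by blast
    have "\<forall>\<^sub>F n in at_top. 1 / (c / (2 * (T + 1))) \<le> L n"
      using subpolynomial_log_large[OF assms(3,4), of "c / (2 * (T + 1))"] c
      unfolding L_def by (auto elim: eventually_mono)
    with T low show ?thesis
    proof eventually_elim
      case (elim n)
      \<comment> \<open>Shorter goals are easier for Maker, so failure at one value bounds all
        attainable ones; this makes the \<open>GREATEST\<close> in \<open>threshold\<close> a true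
        maximum.\<close>
      have le: "s \<le> nat \<lceil>(g + \<epsilon>) * L n\<rceil> + T" if "maker_ensures (b n) (copy_hypergraph H n) s" for s
        using elim(1) that maker_ensures_antimono nat_le_linear by blast
      have lo: "nat \<lfloor>(g - \<epsilon>) * L n\<rfloor> \<le> \<tau> n"
        unfolding \<tau>_def threshold_def using elim(2) le by (rule Greatest_le_nat)
      have "maker_ensures (b n) (copy_hypergraph H n) (\<tau> n)"
        unfolding \<tau>_def threshold_def using elim(2) le by (rule GreatestI_nat)
      then have hi: "\<tau> n \<le> nat \<lceil>(g + \<epsilon>) * L n\<rceil> + T" by (rule le)
      \<comment> \<open>Covers the \<open>T\<close> extra stages and the error 1 of
        rounding.\<close>
      have L: "2 * (real T + 1) \<le> c * L n" using elim(3) c by (simp add: field_simps)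
      then have "0 < c * L n" by (smt (verit) of_nat_0_le_iff)
      then have L0: "0 < L n" using c by (simp add: zero_less_mult_iff)
      have \<epsilon>L: "\<epsilon> * L n \<le> c / 2 * L n" using \<epsilon>(2) L0 by (intro mult_right_mono) auto
      have "real (\<tau> n) \<le> real (nat \<lceil>(g + \<epsilon>) * L n\<rceil>) + T" using hi by linarith
      also have "real (nat \<lceil>(g + \<epsilon>) * L n\<rceil>) \<le> (g + \<epsilon>) * L n + 1"
        using L0 g0 \<epsilon>(1) by (simp add: of_nat_ceiling)
      finally have 1: "real (\<tau> n) \<le> (g + c) * L n" using L \<epsilon>L by (simp add: algebra_simps)
      have "(g - \<epsilon>) * L n - 1 \<le> real (nat \<lfloor>(g - \<epsilon>) * L n\<rfloor>)" by linarith
      then have "(g - \<epsilon>) * L n - 1 \<le> real (\<tau> n)" using lo by linarith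
      then have 2: "(g - c) * L n \<le> real (\<tau> n)" using L \<epsilon>L by (simp add: algebra_simps)
      have "g - c \<le> real (\<tau> n) / L n" "real (\<tau> n) / L n \<le> g + c"
        using 1 2 L0 by (simp_all add: field_simps)
      then show ?case by (simp add: \<delta>_def abs_le_iff)
    qed
  qed
  then have "\<delta> \<in> o(\<lambda>_. 1)" by (rule landau_o.smallI)
  \<comment> \<open>For large \<open>n\<close> the logarithm is at least 1, so the division in the
    definition of \<delta> can be undone.\<close>
  moreover have "\<forall>\<^sub>F n in at_top. real (\<tau> n) = (g + \<delta> n) * L n"
    using subpolynomial_log_large[OF assms(3,4), of 1, simplified]
  proof eventually_elim
    case (elim n)
    then show ?case by (simp add: \<delta>_def L_def)
  qed
  ultimately show ?thesis unfolding g_def \<tau>_def L_def by blast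
qed

end
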